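(* Let $(X,\mathbf R)$ be a symmetric association scheme with $D\ge3$ classes which is metric with respect to $A_0,\dots,A_D$ and cometric with respect to $E_0,\dots,E_D$, and which is not an ordinary cycle. Let $Y\subseteq X$ with $1<|Y|<|X|$ and set $\delta=\delta(Y)$. Let $0\le t\le D$ and suppose that $E_k^*(x)\chi_Y$ is a relative $t$-design with respect to $x$ for every $0\le k\le D$ and every $x\in Y$. Suppose further that for every $x\in Y$, each irreducible $T(x)$-module $W\subseteq V$ with $1\le r(W)\le\delta$ satisfies $r^*(W)\le r(W)$. Then one of the following holds: (i) $(X,R_1)$ is bipartite and $Y$ is one of its two bipartite halves (colour classes); (ii) $(X,\mathbf R)$ is an antipodal double cover and $Y=\{x,y\}$ is an antipodal pair, i.e. $(x,y)\in R_D$; (iii) $\delta\ge t+1$.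
   Context: $(X,\mathbf R)$ is a symmetric association scheme with associate matrices $A_0=I,\dots,A_D$, Bose–Mesner algebra $M$, primitive idempotents $E_0=|X|^{-1}J,\dots,E_D$. Metric: $(X,R_1)$ is distance-regular with $R_i$ its distance-$i$ relation. Cometric: each $E_j$ is a polynomial of degree exactly $j$ in $E_1$ under entrywise multiplication. Antipodal double cover: the relation "$y=z$ or $(y,z)\in R_D$" is an equivalence relation on $X$ whose classes all have size $2$. $V=\mathbb C^X$ with standard basis $\{\hat y\}$ and standard Hermitian inner product; $\chi_Y=\sum_{y\in Y}\hat y$. $\delta(Y)=\min\{i\ne0:\langle\chi_Y,A_i\chi_Y\rangle\ne0\}$ (minimum distance). $E_i^*(x)$ diagonal with $(E_i^*(x))_{yy}=(A_i)_{xy}$; $A_i^*(x)$ diagonal with $(A_i^*(x))_{yy}=|X|(E_i)_{xy}$; $T(x)$ generated by $M$ and the $A_i^*(x)$. For an irreducible $T(x)$-module $W$: $r(W)=\min\{i:E_i^*(x)W\ne0\}$, $r^*(W)=\min\{j:E_jW\ne0\}$. $\psi$ is a relative $t$-design with respect to $x$ if $E_j\psi$ and $E_j\hat x$ are linearly dependent for all $1\le j\le t$. *)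

theory Defs
  imports Complex_Main "HOL-Computational_Algebra.Polynomial"
begin

text \<open>The vertex set X is the finite type 'x (X = UNIV); V = 'x \<Rightarrow> complex;
  matrices are functions 'x \<Rightarrow> 'x \<Rightarrow> complex.\<close>

type_synonym 'x cvec = "'x \<Rightarrow> complex"
type_synonym 'x cmat = "'x \<Rightarrow> 'x \<Rightarrow> complex"

definition mmult :: "'x::finite cmat \<Rightarrow> 'x cmat \<Rightarrow> 'x cmat" where
  "mmult A B = (\<lambda>x y. \<Sum>z\<in>UNIV. A x z * B z y)"

definition mvec :: "'x::finite cmat \<Rightarrow> 'x cvec \<Rightarrow> 'x cvec" where
  "mvec A v = (\<lambda>x. \<Sum>y\<in>UNIV. A x y * v y)"

definition zmat :: "'x cmat" where "zmat = (\<lambda>x y. 0)"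
definition zvec :: "'x cvec" where "zvec = (\<lambda>x. 0)"

definition adj :: "('x \<times> 'x) set \<Rightarrow> 'x cmat" where
  "adj S = (\<lambda>x y. if (x, y) \<in> S then 1 else 0)"

definition assoc_scheme :: "nat \<Rightarrow> (nat \<Rightarrow> ('x::finite \<times> 'x) set) \<Rightarrow> bool" where
  "assoc_scheme D R \<longleftrightarrow>
     1 \<le> D \<and>
     (\<forall>i\<le>D. R i \<noteq> {}) \<and>
     R 0 = Id \<and>
     (\<forall>x y. \<exists>!i. i \<le> D \<and> (x, y) \<in> R i) \<and>
     (\<forall>i\<le>D. sym (R i)) \<and>
     (\<forall>i\<le>D. \<forall>j\<le>D. \<forall>k\<le>D. \<exists>p::nat. \<forall>x y. (x, y) \<in> R k \<longrightarrow>
          card {z. (x, z) \<in> R i \<and> (z, y) \<in> R j} = p)"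

definition bose_mesner :: "nat \<Rightarrow> (nat \<Rightarrow> ('x::finite \<times> 'x) set) \<Rightarrow> 'x cmat set" where
  "bose_mesner D R = {B. \<exists>c::nat \<Rightarrow> complex. B = (\<lambda>x y. \<Sum>i\<le>D. c i * adj (R i) x y)}"

definition primitive_idempotent :: "'x::finite cmat set \<Rightarrow> 'x cmat \<Rightarrow> bool" where
  "primitive_idempotent M E \<longleftrightarrow>
     E \<in> M \<and> mmult E E = E \<and> E \<noteq> zmat \<and>
     (\<forall>F\<in>M. mmult F F = F \<and> mmult F E = F \<longrightarrow> F = zmat \<or> F = E)"

definition primitive_idempotents :: "nat \<Rightarrow> (nat \<Rightarrow> ('x::finite \<times> 'x) set) \<Rightarrow> (nat \<Rightarrow> 'x cmat) \<Rightarrow> bool" where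
  "primitive_idempotents D R E \<longleftrightarrow>
     inj_on E {..D} \<and>
     E ` {..D} = {F. primitive_idempotent (bose_mesner D R) F} \<and>
     E 0 = (\<lambda>x y. 1 / of_nat (card (UNIV :: 'x set)))"

definition metric_scheme :: "nat \<Rightarrow> (nat \<Rightarrow> ('x \<times> 'x) set) \<Rightarrow> bool" where
  "metric_scheme D R \<longleftrightarrow>
     (\<forall>i\<le>D. \<forall>x y. (x, y) \<in> R i \<longleftrightarrow>
        ((x, y) \<in> (R 1) ^^ i \<and> (\<forall>j<i. (x, y) \<notin> (R 1) ^^ j)))"

text \<open>Cometric: E j is a polynomial of degree exactly j in E 1 under entrywise product
  (entrywise evaluation of a polynomial; the constant term multiplies J).\<close>
definition cometric :: "nat \<Rightarrow> (nat \<Rightarrow> 'x cmat) \<Rightarrow> bool" where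
  "cometric D E \<longleftrightarrow>
     (\<forall>j\<le>D. \<exists>p::complex poly. degree p = j \<and> E j = (\<lambda>x y. poly p (E 1 x y)))"

definition is_cycle_graph :: "('x::finite \<times> 'x) set \<Rightarrow> bool" where
  "is_cycle_graph G \<longleftrightarrow>
     (\<exists>(n::nat) f. n \<ge> 3 \<and> bij_betw f {..<n} UNIV \<and>
        (\<forall>i<n. \<forall>j<n. (f i, f j) \<in> G \<longleftrightarrow> (j = (i + 1) mod n \<or> i = (j + 1) mod n)))"

definition bipartite_half :: "('x \<times> 'x) set \<Rightarrow> 'x set \<Rightarrow> bool" where
  "bipartite_half G Y \<longleftrightarrow> Y \<noteq> {} \<and> Y \<noteq> UNIV \<and>
     (\<forall>x y. (x, y) \<in> G \<longrightarrow> (x \<in> Y \<longleftrightarrow> y \<notin> Y))"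

definition antipodal_double_cover :: "nat \<Rightarrow> (nat \<Rightarrow> ('x::finite \<times> 'x) set) \<Rightarrow> bool" where
  "antipodal_double_cover D R \<longleftrightarrow>
     equiv UNIV (Id \<union> R D) \<and> (\<forall>x. card {y. (x, y) \<in> Id \<union> R D} = 2)"

definition chi :: "'x set \<Rightarrow> 'x cvec" where
  "chi Y = (\<lambda>y. if y \<in> Y then 1 else 0)"

definition hat :: "'x \<Rightarrow> 'x cvec" where
  "hat x = chi {x}"

definition cinner :: "'x::finite cvec \<Rightarrow> 'x cvec \<Rightarrow> complex" where
  "cinner u v = (\<Sum>y\<in>UNIV. u y * cnj (v y))"

definition min_dist :: "nat \<Rightarrow> (nat \<Rightarrow> ('x::finite \<times> 'x) set) \<Rightarrow> 'x set \<Rightarrow> nat" where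
  "min_dist D R Y = (LEAST i. i \<noteq> 0 \<and> i \<le> D \<and> cinner (chi Y) (mvec (adj (R i)) (chi Y)) \<noteq> 0)"

definition estar :: "(nat \<Rightarrow> ('x \<times> 'x) set) \<Rightarrow> nat \<Rightarrow> 'x \<Rightarrow> 'x cmat" where
  "estar R i x = (\<lambda>y z. if y = z then adj (R i) x y else 0)"

definition astar :: "(nat \<Rightarrow> 'x::finite cmat) \<Rightarrow> nat \<Rightarrow> 'x \<Rightarrow> 'x cmat" where
  "astar E i x = (\<lambda>y z. if y = z then of_nat (card (UNIV :: 'x set)) * E i x y else 0)"

inductive_set talg :: "nat \<Rightarrow> (nat \<Rightarrow> ('x::finite \<times> 'x) set) \<Rightarrow> (nat \<Rightarrow> 'x cmat) \<Rightarrow> 'x \<Rightarrow> 'x cmat set"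
  for D R E x where
  bm: "B \<in> bose_mesner D R \<Longrightarrow> B \<in> talg D R E x"
| dual: "i \<le> D \<Longrightarrow> astar E i x \<in> talg D R E x"
| add: "B \<in> talg D R E x \<Longrightarrow> C \<in> talg D R E x \<Longrightarrow> (\<lambda>y z. B y z + C y z) \<in> talg D R E x"
| smult: "B \<in> talg D R E x \<Longrightarrow> (\<lambda>y z. c * B y z) \<in> talg D R E x"
| mult: "B \<in> talg D R E x \<Longrightarrow> C \<in> talg D R E x \<Longrightarrow> mmult B C \<in> talg D R E x"

definition csubspace :: "'x cvec set \<Rightarrow> bool" where
  "csubspace W \<longleftrightarrow> zvec \<in> W \<and> (\<forall>u\<in>W. \<forall>v\<in>W. (\<lambda>y. u y + v y) \<in> W) \<and>
     (\<forall>c. \<forall>u\<in>W. (\<lambda>y. c * u y) \<in> W)"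

definition tmodule :: "nat \<Rightarrow> (nat \<Rightarrow> ('x::finite \<times> 'x) set) \<Rightarrow> (nat \<Rightarrow> 'x cmat) \<Rightarrow> 'x \<Rightarrow> 'x cvec set \<Rightarrow> bool" where
  "tmodule D R E x W \<longleftrightarrow> csubspace W \<and> (\<forall>B\<in>talg D R E x. \<forall>w\<in>W. mvec B w \<in> W)"

definition irreducible_tmodule :: "nat \<Rightarrow> (nat \<Rightarrow> ('x::finite \<times> 'x) set) \<Rightarrow> (nat \<Rightarrow> 'x cmat) \<Rightarrow> 'x \<Rightarrow> 'x cvec set \<Rightarrow> bool" where
  "irreducible_tmodule D R E x W \<longleftrightarrow> tmodule D R E x W \<and> W \<noteq> {zvec} \<and>
     (\<forall>U. tmodule D R E x U \<and> U \<subseteq> W \<longrightarrow> U = {zvec} \<or> U = W)"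

definition endpoint :: "nat \<Rightarrow> (nat \<Rightarrow> ('x::finite \<times> 'x) set) \<Rightarrow> 'x \<Rightarrow> 'x cvec set \<Rightarrow> nat" where
  "endpoint D R x W = (LEAST i. i \<le> D \<and> (\<exists>w\<in>W. mvec (estar R i x) w \<noteq> zvec))"

definition dual_endpoint :: "nat \<Rightarrow> (nat \<Rightarrow> 'x::finite cmat) \<Rightarrow> 'x cvec set \<Rightarrow> nat" where
  "dual_endpoint D E W = (LEAST j. j \<le> D \<and> (\<exists>w\<in>W. mvec (E j) w \<noteq> zvec))"

definition lin_dep2 :: "'x cvec \<Rightarrow> 'x cvec \<Rightarrow> bool" where
  "lin_dep2 u v \<longleftrightarrow> (\<exists>a b::complex. (a, b) \<noteq> (0, 0) \<and> (\<lambda>y. a * u y + b * v y) = zvec)"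

definition relative_design :: "(nat \<Rightarrow> 'x::finite cmat) \<Rightarrow> nat \<Rightarrow> 'x \<Rightarrow> 'x cvec \<Rightarrow> bool" where
  "relative_design E t x psi \<longleftrightarrow>
     (\<forall>j. 1 \<le> j \<and> j \<le> t \<longrightarrow> lin_dep2 (mvec (E j) psi) (mvec (E j) (hat x)))"

end

theory Submission
  imports Defs "HOL-Library.Function_Algebras"
begin

text \<open>
  Suppose \<open>\<delta> \<le> t\<close>, let \<open>x \<in> Y\<close> have a codeword at distance \<open>\<delta>\<close>, and let \<open>\<psi>\<close> be the part of
  \<open>\<chi>\<^sub>Y\<close> at distance \<open>\<delta>\<close> from \<open>x\<close>. If \<open>\<psi>\<close> were not a multiple of the sphere \<open>A\<^sub>\<delta> x\<close>, some
  irreducible \<open>T(x)\<close>-module \<open>W\<close> orthogonal to the primary module would not be orthogonal to \<open>\<psi>\<close>.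
  The design property makes \<open>\<psi>\<close> orthogonal to \<open>E\<^sub>j W\<close> for \<open>j \<le> t\<close>, and \<open>r\<^sup>*(W) \<le> r(W)\<close> together
  with the tridiagonal action of \<open>A\<close> and \<open>A\<^sup>*\<close> then forces \<open>\<psi>\<close> to be orthogonal to \<open>W\<close>.
  Hence the whole sphere of radius \<open>\<delta>\<close> around \<open>x\<close> lies in \<open>Y\<close>.

  A proper subset closed under the distance-\<open>\<delta>\<close> relation with minimum distance \<open>\<delta>\<close> forces
  \<open>\<delta> = 2\<close> with \<open>Y\<close> a bipartite half, or \<open>\<delta> = D\<close> with \<open>Y\<close> an antipodal fibre: for
  \<open>2 < \<delta> < D\<close> the intersection numbers give \<open>c\<^sub>\<delta> = b\<^sub>\<delta> = 1\<close> and \<open>a\<^sub>\<delta> = 0\<close>, so the graph is a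
  cycle. Finally, fibres have size two: otherwise, since \<open>E\<^sub>2\<close> is a quadratic polynomial in \<open>E\<^sub>1\<close>,
  comparing values on \<open>R\<^sub>0\<close>, \<open>R\<^sub>1\<close>, \<open>R\<^bsub>D-1\<^esub>\<close>, \<open>R\<^sub>D\<close> shows that \<open>E\<^sub>1\<close> takes opposite values on
  \<open>R\<^sub>0\<close> and \<open>R\<^sub>1\<close>, and then equal values on \<open>R\<^sub>0\<close> and \<open>R\<^sub>2\<close>, which is impossible.
\<close>

subsection \<open>Finite-dimensional linear algebra\<close>

text \<open>Pointwise scaling; with the pointwise addition of functions it makes the function space
  an instance of the abstract vector space theory, with the vectors \<open>hat x\<close> as
  basis.\<close>

definition cscale :: "complex \<Rightarrow> ('a \<Rightarrow> complex) \<Rightarrow> 'a \<Rightarrow> complex" where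
  "cscale c v = (\<lambda>y. c * v y)"

lemma sum_fun_apply: "(\<Sum>i\<in>I. f i) y = (\<Sum>i\<in>I. f i y)" for f :: "'i \<Rightarrow> 'a \<Rightarrow> 'b::comm_monoid_add"
  by (induction I rule: infinite_finite_induct) auto

lemma hat_apply: "hat x y = (if y = x then 1 else 0)"
  by (simp add: hat_def chi_def)

lemma inj_hat: "inj hat"
  by (rule injI) (metis hat_apply zero_neq_one)

interpretation cfun: vector_space "cscale :: complex \<Rightarrow> ('a \<Rightarrow> complex) \<Rightarrow> _"
  by unfold_locales (auto simp: cscale_def fun_eq_iff algebra_simps)

lemma sum_scaled_hat: "(\<Sum>v\<in>range hat. cscale (u v) v) y = u (hat y)" for y :: "'a::finite"
proof -
  have "(\<Sum>v\<in>range hat. cscale (u v) v) y = (\<Sum>x\<in>UNIV. cscale (u (hat x)) (hat x)) y"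
    by (subst sum.reindex[OF inj_hat]) simp
  also have "\<dots> = (\<Sum>x\<in>UNIV. if y = x then u (hat x) else 0)"
    unfolding sum_fun_apply by (rule sum.cong) (auto simp: cscale_def hat_apply)
  finally show ?thesis by simp
qed

lemma finite_dimensional_cscale: "finite_dimensional_vector_space
  (cscale :: complex \<Rightarrow> ('a::finite \<Rightarrow> complex) \<Rightarrow> _) (range hat)"
proof unfold_locales
  show fin: "finite (range (hat :: 'a \<Rightarrow> _))" by simp
  show "\<not> cfun.dependent (range (hat :: 'a \<Rightarrow> _))"
  proof (rule cfun.independent_if_scalars_zero[OF fin])
    fix f :: "('a \<Rightarrow> complex) \<Rightarrow> complex" and v :: "'a \<Rightarrow> complex"
    assume 0: "(\<Sum>v\<in>range hat. cscale (f v) v) = 0" and v: "v \<in> range hat"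
    from v obtain y where "v = hat y" by blast
    with sum_scaled_hat[of f y] show "f v = 0" by (simp add: 0)
  qed
  have "v \<in> cfun.span (range hat)" for v :: "'a \<Rightarrow> complex"
  proof -
    have "v = (\<Sum>w\<in>range hat. cscale (v (inv hat w)) w)"
      by (rule ext) (simp add: sum_scaled_hat inv_f_f[OF inj_hat])
    also have "\<dots> \<in> cfun.span (range hat)"
      by (intro cfun.span_sum cfun.span_scale cfun.span_base)
    finally show ?thesis .
  qed
  then show "cfun.span (range (hat :: 'a \<Rightarrow> _)) = UNIV" by blast
qed

interpretation cfun: finite_dimensional_vector_space
  "cscale :: complex \<Rightarrow> ('a::finite \<Rightarrow> complex) \<Rightarrow> _" "range hat"
  by (rule finite_dimensional_cscale)

lemma csubspace_imp_subspace: "csubspace W \<Longrightarrow> cfun.subspace W"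
  by (auto simp: csubspace_def cfun.subspace_def cscale_def zvec_def zero_fun_def plus_fun_def)

lemma csubspace_sum:
  assumes "csubspace W" "\<And>i. i \<in> I \<Longrightarrow> f i \<in> W"
  shows "(\<lambda>y. \<Sum>i\<in>I. f i y) \<in> W"
  using cfun.subspace_sum[OF csubspace_imp_subspace[OF assms(1)], of I f] assms(2)
  by (simp add: sum_fun_apply[abs_def])

text \<open>A nonzero submodule of least dimension leaves no room for a smaller nonzero one.\<close>

lemma exists_irreducible_submodule:
  assumes U: "tmodule D R E x U" "U \<noteq> {zvec}"
  shows "\<exists>W\<subseteq>U. irreducible_tmodule D R E x W"
proof -
  let ?P = "\<lambda>W. tmodule D R E x W \<and> W \<noteq> {zvec} \<and> W \<subseteq> U"
  obtain W where W: "?P W" and min: "\<And>W'. ?P W' \<Longrightarrow> cfun.dim W \<le> cfun.dim W'"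
    using ex_has_least_nat[of ?P U cfun.dim] U by blast
  have "U' = {zvec} \<or> U' = W" if U': "tmodule D R E x U'" "U' \<subseteq> W" for U'
  proof (cases "U' = {zvec}")
    case False
    with U' W min have "cfun.dim W \<le> cfun.dim U'" by blast
    moreover have "cfun.subspace U'" "cfun.subspace W"
      using U' W by (auto simp: tmodule_def intro: csubspace_imp_subspace)
    ultimately show ?thesis using U'(2) cfun.subspace_dim_equal by blast
  qed simp
  with W show ?thesis unfolding irreducible_tmodule_def by blast
qed

subsection \<open>Distances in metric schemes\<close>

locale metric_assoc_scheme =
  fixes D :: nat and R :: "nat \<Rightarrow> ('x::finite \<times> 'x) set"
  assumes scheme: "assoc_scheme D R" and metric: "metric_scheme D R"
begin

text \<open>In a metric scheme this index is the path distance in the graph \<open>R 1\<close>, so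
  later arguments speak of distances instead of relations.\<close>

definition dst :: "'x \<Rightarrow> 'x \<Rightarrow> nat" where
  "dst x y = (THE i. i \<le> D \<and> (x, y) \<in> R i)"

lemma dst_le: "dst x y \<le> D" and dst_R: "(x, y) \<in> R (dst x y)"
proof -
  have "\<exists>!i. i \<le> D \<and> (x, y) \<in> R i" using scheme by (simp add: assoc_scheme_def)
  from theI'[OF this] show "dst x y \<le> D" "(x, y) \<in> R (dst x y)" by (auto simp: dst_def)
qed

lemma R_iff: "i \<le> D \<Longrightarrow> (x, y) \<in> R i \<longleftrightarrow> dst x y = i"
proof -
  assume "i \<le> D"
  moreover have "\<exists>!i. i \<le> D \<and> (x, y) \<in> R i" using scheme by (simp add: assoc_scheme_def)
  ultimately show ?thesis using dst_le dst_R by blast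
qed

lemma D_pos: "1 \<le> D"
  using scheme by (simp add: assoc_scheme_def)

lemma dst_eq_0: "dst x y = 0 \<longleftrightarrow> x = y"
  using R_iff[of 0 x y] scheme by (auto simp: assoc_scheme_def)

lemma dst_refl [simp]: "dst x x = 0"
  by (simp add: dst_eq_0)

lemma dst_sym: "dst x y = dst y x"
proof -
  have "sym (R (dst x y))" using scheme dst_le by (simp add: assoc_scheme_def)
  then have "(y, x) \<in> R (dst x y)" using dst_R by (meson symD)
  then show ?thesis using R_iff dst_le by metis
qed

lemma dst_eq_1: "(x, y) \<in> R 1 \<longleftrightarrow> dst x y = 1"
  using R_iff D_pos by simp

lemma dst_relpow: "(x, y) \<in> R 1 ^^ dst x y"
  using metric dst_le dst_R unfolding metric_scheme_def by blast

lemma dst_le_relpow: "(x, y) \<in> R 1 ^^ m \<Longrightarrow> dst x y \<le> m"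
  using metric dst_le dst_R unfolding metric_scheme_def by (meson not_le)

lemma dst_triangle: "dst x z \<le> dst x y + dst y z"
proof -
  have "(x, z) \<in> R 1 ^^ (dst x y + dst y z)"
    using dst_relpow[of x y] dst_relpow[of y z] by (auto simp: relpow_add)
  then show ?thesis by (rule dst_le_relpow)
qed

lemma dst_intermediate:
  assumes "dst x y = a + b"
  obtains z where "dst x z = a" "dst z y = b"
proof -
  have "(x, y) \<in> R 1 ^^ a O R 1 ^^ b"
    using dst_relpow[of x y] assms by (simp add: relpow_add)
  then obtain z where "(x, z) \<in> R 1 ^^ a" "(z, y) \<in> R 1 ^^ b" by blast
  then have "dst x z \<le> a" "dst z y \<le> b" by (auto intro: dst_le_relpow)
  with dst_triangle[of x y z] assms have "dst x z = a" "dst z y = b" by linarith+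
  then show ?thesis by (rule that)
qed

lemma card_dst_cong:
  assumes "dst x y = dst x' y'"
  shows "card {z. dst x z = i \<and> dst z y = j} = card {z. dst x' z = i \<and> dst z y' = j}"
proof (cases "i \<le> D \<and> j \<le> D")
  case True
  then have "\<exists>p. \<forall>u v. (u, v) \<in> R (dst x y) \<longrightarrow> card {z. (u, z) \<in> R i \<and> (z, v) \<in> R j} = p"
    using scheme dst_le[of x y] by (simp add: assoc_scheme_def)
  then obtain p where p: "\<And>u v. (u, v) \<in> R (dst x y) \<Longrightarrow>
      card {z. (u, z) \<in> R i \<and> (z, v) \<in> R j} = p"
    by blast
  have "card {z. (x, z) \<in> R i \<and> (z, y) \<in> R j} = card {z. (x', z) \<in> R i \<and> (z, y') \<in> R j}"
    using p[of x y] p[of x' y'] dst_R[of x y] dst_R[of x' y'] assms by simp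
  with True show ?thesis by (simp add: R_iff)
next
  case False
  then have "{z. dst u z = i \<and> dst z v = j} = {}" for u v
    using dst_le[of u] dst_le[of _ v] by fastforce
  then show ?thesis by (simp only:)
qed

text \<open>An intersection number that is nonzero at one pair is nonzero at every pair with the
  same distance, so a third vertex can be transported between pairs.\<close>

lemma dst_transfer:
  assumes "dst x y = dst x' y'" "dst x z = i" "dst z y = j"
  obtains z' where "dst x' z' = i" "dst z' y' = j"
proof -
  have "card {z. dst x z = i \<and> dst z y = j} \<noteq> 0" using assms by auto
  then have "{z. dst x' z = i \<and> dst z y' = j} \<noteq> {}"
    using card_dst_cong[OF assms(1), of i j] by (metis card.empty)
  with that show ?thesis by blast
qed

lemma ex_dst:
  assumes "i \<le> D"
  obtains y where "dst x y = i"
proof -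
  have "R i \<noteq> {}" using scheme assms by (simp add: assoc_scheme_def)
  then obtain u v where "dst u v = i" using R_iff[OF assms] by (metis ex_in_conv surj_pair)
  then show ?thesis using dst_transfer[of u u x x v i i] that dst_sym by auto
qed

section \<open>Valency, connectedness and cycles\<close>

definition valency :: nat where
  "valency = card {z. dst undefined z = 1}"

lemma card_nbrs: "card {z. dst x z = 1} = valency"
  using card_dst_cong[of x x undefined undefined 1 1] by (simp add: valency_def dst_sym)

lemma closed_under_nbrs_UNIV:
  assumes "x \<in> S" "\<And>y z. y \<in> S \<Longrightarrow> dst y z = 1 \<Longrightarrow> z \<in> S"
  shows "S = UNIV"
proof -
  have "z \<in> S" if "(x, z) \<in> R 1 ^^ m" for m z
    using that
  proof (induction m arbitrary: z)
    case (Suc m)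
    then obtain y where "(x, y) \<in> R 1 ^^ m" "(y, z) \<in> R 1" by auto
    with Suc.IH assms(2) show ?case by (metis dst_eq_1)
  qed (use assms in simp)
  with dst_relpow show ?thesis by blast
qed

text \<open>A walk that never turns back must revisit a vertex. With valency two the first revisit
  is to its start, and the closed walk, being closed under neighbours, covers the connected
  graph.\<close>

lemma valency_2_imp_cycle:
  assumes v2: "valency = 2"
  shows "is_cycle_graph (R 1)"
proof -
  have nbrs: "\<exists>w. w \<noteq> u \<and> {z. dst v z = 1} = {u, w}" if "dst v u = 1" for u v
  proof -
    obtain p q where "{z. dst v z = 1} = {p, q}" "p \<noteq> q"
      using card_nbrs[of v] v2 by (auto simp: card_2_iff)
    moreover from this that have "u = p \<or> u = q" by blast
    ultimately show ?thesis by (metis insert_commute)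
  qed
  define other where "other u v = (SOME w. w \<noteq> u \<and> {z. dst v z = 1} = {u, w})" for u v
  have other: "other u v \<noteq> u" "{z. dst v z = 1} = {u, other u v}" if "dst v u = 1" for u v
    using someI_ex[OF nbrs[OF that]] by (auto simp: other_def)
  obtain y0 :: 'x where y0: "dst undefined y0 = 1" using ex_dst[OF D_pos] by blast
  \<comment> \<open>The state of the walk is a directed edge, since the next vertex depends on the
    last two; \<open>f\<close> lists the tails of these edges.\<close>
  define g where "g m = ((\<lambda>(u, v). (v, other u v)) ^^ m) (undefined, y0)" for m
  define f where "f m = fst (g m)" for m
  have g_Suc: "g (Suc m) = (snd (g m), other (fst (g m)) (snd (g m)))" for m
    by (simp add: g_def case_prod_beta)
  have snd_g: "snd (g m) = f (Suc m)" for m by (simp add: f_def g_Suc)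
  have f_SS: "f (Suc (Suc m)) = other (f m) (f (Suc m))" for m
    by (metis f_def g_Suc snd_g snd_conv)
  have step: "dst (f m) (f (Suc m)) = 1" for m
  proof (induction m)
    case 0
    have "g 0 = (undefined, y0)" by (simp add: g_def)
    then show ?case using y0 snd_g[of 0] by (simp add: f_def)
  next
    case (Suc m)
    then have "dst (f (Suc m)) (f m) = 1" by (simp add: dst_sym)
    from other(2)[OF this] show ?case by (auto simp: f_SS)
  qed
  have f_nbrs: "{z. dst (f (Suc m)) z = 1} = {f m, f (Suc (Suc m))}"
    and f_ne2: "f (Suc (Suc m)) \<noteq> f m" for m
    using other[of "f (Suc m)" "f m"] step[of m] by (auto simp: f_SS dst_sym)
  have f_ne1: "f (Suc m) \<noteq> f m" for m using step[of m] by (metis dst_refl zero_neq_one)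
  have "\<not> inj f" using finite_imageD[of f UNIV] by (metis finite infinite_UNIV_nat)
  then obtain i j where ij: "i < j" "f i = f j" by (metis injI linorder_neqE_nat)
  define n where "n = (LEAST n. \<exists>j<n. f j = f n)"
  have "\<exists>j<n. f j = f n" unfolding n_def by (rule LeastI_ex) (use ij in blast)
  then obtain j0 where j0: "j0 < n" "f j0 = f n" by blast
  have least: "\<not> (\<exists>j<m. f j = f m)" if "m < n" for m
    using that unfolding n_def by (rule not_less_Least)
  have inj: "i = j" if "i < n" "j < n" "f i = f j" for i j
    using that least by (metis linorder_neqE_nat)
  \<comment> \<open>The vertex before the revisit is adjacent to \<open>f j0\<close>. If
    \<open>j0\<close> were positive, it would have to be one of the two walk neighbours of
    \<open>f j0\<close>, which contradicts the minimality of \<open>n\<close> or one of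
    \<open>f_ne1\<close>, \<open>f_ne2\<close>.\<close>
  have j00: "j0 = 0"
  proof (rule ccontr)
    assume "j0 \<noteq> 0"
    then obtain j where j: "j0 = Suc j" by (cases j0) auto
    obtain m where m: "n = Suc m" using j0 by (cases n) auto
    have "f m \<in> {z. dst (f j0) z = 1}" using step[of m] j0 m by (simp add: dst_sym)
    then have "f m = f j \<or> f m = f (Suc j0)" unfolding j f_nbrs by simp
    moreover have "m \<noteq> j" using j0 j m by simp
    moreover have "Suc j0 < n \<or> Suc j0 = n" using j0 by auto
    ultimately have "Suc j0 = n \<or> m = Suc j0"
      using inj[of m j] inj[of m "Suc j0"] j0 j m by auto
    then show False using f_ne1[of j0] f_ne2[of j0] j0 m by auto
  qed
  have fn: "f n = f 0" using j0 j00 by simp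
  have n3: "n \<ge> 3"
  proof -
    have "n \<noteq> 0" "n \<noteq> 1" "n \<noteq> 2"
      using j0 f_ne1[of 0] f_ne2[of 0] fn by (auto simp: numeral_2_eq_2)
    then show ?thesis by linarith
  qed
  have fSuc: "f (Suc i) = f (Suc i mod n)" if "i < n" for i
    using that fn by (cases "Suc i = n") auto
  have mod_inj: "i = j" if "i < n" "j < n" "Suc i mod n = Suc j mod n" for i j
    using that n3 by (auto simp: mod_Suc split: if_splits)
  have nb: "dst (f i) z = 1 \<longleftrightarrow> z = f (Suc i mod n) \<or> (\<exists>j<n. i = Suc j mod n \<and> z = f j)"
    if i: "i < n" for i z
  proof (cases i)
    case (Suc m)
    have "dst (f i) z = 1 \<longleftrightarrow> z = f m \<or> z = f (Suc i)"
      using f_nbrs[of m] Suc by blast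
    moreover have mn: "m < n" "i = Suc m mod n" using i Suc by auto
    then have "i = Suc j mod n \<longleftrightarrow> j = m" if "j < n" for j
      using mod_inj that by metis
    ultimately show ?thesis using fSuc[OF i] mn by metis
  next
    case 0
    \<comment> \<open>\<open>f_nbrs\<close> says nothing about the start of the walk; its neighbours
      are found by counting against the valency.\<close>
    define l where "l = n - 1"
    have l: "n = Suc l" "l \<noteq> 1" "l < n" using n3 by (auto simp: l_def)
    have "dst (f 0) (f 1) = 1" "dst (f 0) (f l) = 1"
      using step[of 0] step[of l] l fn by (auto simp: dst_sym)
    moreover have "f 1 \<noteq> f l" using inj[of 1 l] l n3 by auto
    ultimately have "{f 1, f l} = {z. dst (f 0) z = 1}"
      using card_seteq[of "{z. dst (f 0) z = 1}" "{f 1, f l}"] card_nbrs[of "f 0"] v2 by auto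
    then have "dst (f i) z = 1 \<longleftrightarrow> z = f 1 \<or> z = f l" using 0 by blast
    moreover have "0 = Suc l mod n" using l by simp
    then have "0 = Suc j mod n \<longleftrightarrow> j = l" if "j < n" for j
      using mod_inj that l(3) by metis
    moreover have "Suc 0 mod n = 1" using n3 by simp
    ultimately show ?thesis using 0 l(3) by metis
  qed
  have "f ` {..<n} = UNIV"
  proof (rule closed_under_nbrs_UNIV)
    show "f 0 \<in> f ` {..<n}" using n3 by auto
    fix y z assume "y \<in> f ` {..<n}" "dst y z = 1"
    then show "z \<in> f ` {..<n}" using nb n3 by fastforce
  qed
  then have bij: "bij_betw f {..<n} UNIV" by (auto simp: bij_betw_def inj_on_def intro: inj)
  show ?thesis unfolding is_cycle_graph_def
  proof (intro exI conjI allI impI)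
    show "3 \<le> n" "bij_betw f {..<n} UNIV" by fact+
    fix i j assume ij: "i < n" "j < n"
    have "(f i, f j) \<in> R 1 \<longleftrightarrow> f j = f (Suc i mod n) \<or> (\<exists>k<n. i = Suc k mod n \<and> f j = f k)"
      unfolding dst_eq_1 by (rule nb[OF ij(1)])
    also have "f j = f (Suc i mod n) \<longleftrightarrow> j = Suc i mod n"
      using inj[of j "Suc i mod n"] ij n3 by auto
    also have "(\<exists>k<n. i = Suc k mod n \<and> f j = f k) \<longleftrightarrow> i = Suc j mod n"
      using inj[of j] ij by metis
    finally show "(f i, f j) \<in> R 1 \<longleftrightarrow> j = (i + 1) mod n \<or> i = (j + 1) mod n" by simp
  qed
qed

section \<open>Codes closed under their minimum distance\<close>

text \<open>The sphere of radius \<delta> around \<open>x\<close> lies in \<open>Z\<close>, so its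
  points are at least 3 apart and no vertex has two neighbours on it. Read at suitable pairs, this
  bounds the parameters c and b at \<delta> by 1, while the parameter a is 0 by minimality.\<close>

lemma code_middle_distance_valency_2:
  assumes xy: "x \<in> Z" "y \<in> Z" "dst x y = \<delta>" and \<delta>: "3 \<le> \<delta>" "\<delta> < D"
    and min: "\<And>y z. y \<in> Z \<Longrightarrow> z \<in> Z \<Longrightarrow> y \<noteq> z \<Longrightarrow> \<delta> \<le> dst y z"
    and closed: "\<And>y z. y \<in> Z \<Longrightarrow> dst y z = \<delta> \<Longrightarrow> z \<in> Z"
  shows "valency = 2"
proof -
  have uniq: "y = z" if "dst x y = \<delta>" "dst x z = \<delta>" "dst u y = 1" "dst u z = 1" for u y z
  proof (rule ccontr)
    assume "y \<noteq> z"
    then have "\<delta> \<le> dst y z" using min closed that xy by blast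
    moreover have "dst y z \<le> 2" using dst_triangle[of y z u] that by (simp add: dst_sym)
    ultimately show False using \<delta> by simp
  qed
  obtain x1 where x1: "dst x x1 = 1" "dst x1 y = \<delta> - 1"
    using dst_intermediate[of x y 1 "\<delta> - 1"] xy \<delta> by auto
  obtain v where v: "dst x v = \<delta> + 1" using ex_dst[of "\<delta> + 1" x] \<delta> by auto
  obtain x2 where x2: "dst x x2 = 1" "dst x2 v = \<delta>"
    using dst_intermediate[of x v 1 \<delta>] v by auto
  obtain u where u: "dst x u = \<delta> - 1" by (rule ex_dst[of "\<delta> - 1" x]) (use \<delta> in simp)
  have c: "card {z. dst x z = \<delta> - 1 \<and> dst z y = 1} \<le> 1"
  proof -
    have "card {z. dst x z = \<delta> - 1 \<and> dst z y = 1} = card {z. dst x2 z = \<delta> - 1 \<and> dst z v = 1}"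
      by (rule card_dst_cong) (simp add: xy x2)
    also have "\<dots> \<le> 1"
    proof -
      \<comment> \<open>Seen from \<open>x\<close>, which is one step further from \<open>v\<close>
        than \<open>x2\<close> is, the vertices counted lie on the sphere of radius \<delta>, where
        \<open>uniq\<close> applies.\<close>
      have "dst x z = \<delta>" if "dst x2 z = \<delta> - 1" "dst z v = 1" for z
        using that dst_triangle[of x z x2] dst_triangle[of x v z] x2 v \<delta> by linarith
      then have "z = z'" if "dst x2 z = \<delta> - 1" "dst z v = 1" "dst x2 z' = \<delta> - 1" "dst z' v = 1" for z z'
        using uniq[of z z' v] that dst_sym by metis
      then show ?thesis by (auto simp: card_le_Suc0_iff_eq)
    qed
    finally show ?thesis .
  qed
  have b: "card {z. dst x z = \<delta> + 1 \<and> dst z y = 1} \<le> 1"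
  proof -
    \<comment> \<open>The parameter b does not increase with the distance: its value at \<delta> is
      compared with its value at \<delta> - 1, and that one is read at the pair \<open>x\<close>,
      \<open>u\<close>.\<close>
    have "card {z. dst x z = \<delta> + 1 \<and> dst z y = 1} \<le> card {z. dst x1 z = \<delta> \<and> dst z y = 1}"
    proof (rule card_mono)
      show "{z. dst x z = \<delta> + 1 \<and> dst z y = 1} \<subseteq> {z. dst x1 z = \<delta> \<and> dst z y = 1}"
      proof safe
        fix z assume z: "dst x z = \<delta> + 1" "dst z y = 1"
        then show "dst x1 z = \<delta>"
          using dst_triangle[of x z x1] dst_triangle[of x1 z y] x1 \<delta> dst_sym[of y z] by linarith
      qed
    qed simp
    also have "\<dots> = card {z. dst x z = \<delta> \<and> dst z u = 1}"
      by (rule card_dst_cong) (simp add: x1 u)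
    also have "\<dots> \<le> 1"
      using uniq[of _ _ u] by (auto simp: card_le_Suc0_iff_eq dst_sym[of _ u])
    finally show ?thesis .
  qed
  have a: "dst x z \<noteq> \<delta>" if "dst z y = 1" for z
  proof
    assume "dst x z = \<delta>"
    then have "z \<in> Z" using closed xy by blast
    with that min[of z y] xy \<delta> show False by (cases "z = y") auto
  qed
  have eq: "{z. dst z y = 1} = {z. dst x z = \<delta> - 1 \<and> dst z y = 1} \<union> {z. dst x z = \<delta> + 1 \<and> dst z y = 1}"
  proof (intro set_eqI iffI)
    fix z assume "z \<in> {z. dst z y = 1}"
    then have z: "dst z y = 1" by simp
    then have "dst x z \<noteq> \<delta>" "dst x z \<le> \<delta> + 1" "\<delta> \<le> dst x z + 1"
      using a dst_triangle[of x z y] dst_triangle[of x y z] xy dst_sym[of y z] by auto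
    then have "dst x z = \<delta> - 1 \<or> dst x z = \<delta> + 1" by linarith
    with z show "z \<in> {z. dst x z = \<delta> - 1 \<and> dst z y = 1} \<union> {z. dst x z = \<delta> + 1 \<and> dst z y = 1}"
      by blast
  qed blast
  have "card {z. dst z y = 1} \<le> card {z. dst x z = \<delta> - 1 \<and> dst z y = 1}
      + card {z. dst x z = \<delta> + 1 \<and> dst z y = 1}"
    unfolding eq by (rule card_Un_le)
  with c b have le: "valency \<le> 2" using card_nbrs[of y] by (simp add: dst_sym[of y])
  obtain w where w: "dst x w = 2" using ex_dst[of 2 x] \<delta> by auto
  then obtain m where m: "dst x m = 1" "dst m w = 1" using dst_intermediate[of x w 1 1] by auto
  have "x \<noteq> w" using w by auto
  then have "card {x, w} \<le> card {z. dst m z = 1}"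
    using m dst_sym[of x m] by (intro card_mono) auto
  with \<open>x \<noteq> w\<close> have "2 \<le> valency" using card_nbrs[of m] by simp
  with le show ?thesis by simp
qed

text \<open>The parameter a at distance 2 vanishes, which excludes triangles. Every vertex is in
  \<open>Z\<close> or next to it, so an edge outside \<open>Z\<close> would complete a triangle with
  a vertex of \<open>Z\<close>.\<close>

lemma code_distance_2_bipartite:
  assumes D3: "3 \<le> D" and xy: "x \<in> Z" "y \<in> Z" "dst x y = 2"
    and min: "\<And>y z. y \<in> Z \<Longrightarrow> z \<in> Z \<Longrightarrow> dst y z \<noteq> 1"
    and closed: "\<And>y z. y \<in> Z \<Longrightarrow> dst y z = 2 \<Longrightarrow> z \<in> Z"
  shows "dst u v = 1 \<Longrightarrow> u \<in> Z \<longleftrightarrow> v \<notin> Z"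
proof -
  have "{v. \<exists>z\<in>Z. dst z v \<le> 1} = UNIV"
  proof (rule closed_under_nbrs_UNIV)
    show "x \<in> {v. \<exists>z\<in>Z. dst z v \<le> 1}" using xy by force
    fix y z assume "y \<in> {v. \<exists>z\<in>Z. dst z v \<le> 1}" and yz: "dst y z = 1"
    then obtain w where w: "w \<in> Z" "dst w y \<le> 1" by blast
    then have "dst w z \<le> 2" using dst_triangle[of w z y] yz by linarith
    then consider "dst w z \<le> 1" | "dst w z = 2" by linarith
    then show "z \<in> {v. \<exists>z\<in>Z. dst z v \<le> 1}"
    proof cases
      case 2
      then show ?thesis using closed[OF w(1)] by force
    qed (use w in blast)
  qed
  then have cover: "\<exists>z\<in>Z. dst z v \<le> 1" for v by blast
  have a2: "dst z w \<noteq> 1" if mzw: "dst m z = 2" "dst m w = 2" for m z w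
  proof
    assume zw: "dst z w = 1"
    obtain w' where "dst x w' = 2" "dst w' y = 1"
      by (rule dst_transfer[of m z x y w 2 1]) (use mzw xy zw dst_sym[of z w] in simp_all)
    then show False using closed[of x w'] min[of w' y] xy by simp
  qed
  have no_triangle: False if uvw: "dst u v = 1" "dst u w = 1" "dst w v = 1" for u v w
  proof -
    \<comment> \<open>A triangle is transported onto an edge \<open>p\<close>, \<open>q\<close>
      leading from distance 2 to distance 3. Its third vertex \<open>s\<close> is then also at
      distance 3 from \<open>x\<close>, so the adjacent vertices \<open>s\<close>, \<open>q\<close>
      contradict \<open>a2\<close> as seen from \<open>m\<close>.\<close>
    obtain q where q: "dst x q = 3" using ex_dst[of 3 x] D3 by auto
    then obtain p where p: "dst x p = 2" "dst p q = 1" using dst_intermediate[of x q 2 1] by auto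
    then obtain m where m: "dst x m = 1" "dst m p = 1" using dst_intermediate[of x p 1 1] by auto
    obtain s where s: "dst p s = 1" "dst s q = 1"
      using dst_transfer[of u v p q w 1 1] uvw p by auto
    have "s \<in> Z \<Longrightarrow> False" using closed[of x p] min[of p s] xy p s by auto
    then have "dst x s \<noteq> 2" using closed[of x s] xy by blast
    then have "dst x s = 3"
      using dst_triangle[of x q s] dst_triangle[of x s p] p s q by linarith
    then have "dst m s = 2" "dst m q = 2"
      using dst_triangle[of x s m] dst_triangle[of x q m] dst_triangle[of m s p] dst_triangle[of m q p]
        m p s q by linarith+
    then show False using a2 s by blast
  qed
  assume uv: "dst u v = 1"
  have False if "u \<notin> Z" "v \<notin> Z"
  proof -
    obtain z where z: "z \<in> Z" "dst z u \<le> 1" using cover by blast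
    then have "dst z u = 1" using that dst_eq_0[of z u] by fastforce
    moreover have "dst z v \<noteq> 0" "dst z v \<noteq> 2" using that z closed by (auto simp: dst_eq_0)
    moreover have "dst z v \<le> 2" using dst_triangle[of z v u] z uv by linarith
    ultimately show False using no_triangle[of z v u] uv by linarith
  qed
  with min[of u v] uv show "u \<in> Z \<longleftrightarrow> v \<notin> Z" by blast
qed

lemma closed_code_cases:
  assumes D3: "3 \<le> D" and nc: "\<not> is_cycle_graph (R 1)" and Y: "Y \<noteq> UNIV"
    and \<delta>: "1 \<le> \<delta>" "\<delta> \<le> D" and xy: "x \<in> Y" "y \<in> Y" "dst x y = \<delta>"
    and min: "\<And>y z. y \<in> Y \<Longrightarrow> z \<in> Y \<Longrightarrow> y \<noteq> z \<Longrightarrow> \<delta> \<le> dst y z"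
    and closed: "\<And>x y z. x \<in> Y \<Longrightarrow> y \<in> Y \<Longrightarrow> dst x y = \<delta> \<Longrightarrow> dst x z = \<delta> \<Longrightarrow> z \<in> Y"
  shows "bipartite_half (R 1) Y \<or>
    Y = {z. z = x \<or> dst x z = D} \<and>
    (\<forall>u v w. dst u v = D \<longrightarrow> dst v w = D \<longrightarrow> u = w \<or> dst u w = D)"
proof -
  \<comment> \<open>The hypothesis \<open>closed\<close> speaks only of codewords with another
    codeword at distance exactly \<delta>; \<open>Z\<close> collects these and is itself closed
    under that relation.\<close>
  define Z where "Z = {z \<in> Y. \<exists>w\<in>Y. dst z w = \<delta>}"
  have xyZ: "x \<in> Z" "y \<in> Z" using xy dst_sym[of x y] by (auto simp: Z_def)
  have Z_closed: "z \<in> Z" if "w \<in> Z" "dst w z = \<delta>" for w z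
    using that closed[of w _ z] dst_sym[of w z] by (auto simp: Z_def)
  have ZY: "Z \<subseteq> Y" by (auto simp: Z_def)
  have Z_min: "\<delta> \<le> dst z w" if "z \<in> Z" "w \<in> Z" "z \<noteq> w" for z w
    using that ZY min by blast
  have "\<delta> \<noteq> 1"
  proof
    assume "\<delta> = 1"
    then have "Z = UNIV" using closed_under_nbrs_UNIV[of x Z] xyZ Z_closed by blast
    then show False using ZY Y by blast
  qed
  then consider "\<delta> = 2" | "3 \<le> \<delta>" "\<delta> < D" | "\<delta> = D" using \<delta> by linarith
  then show ?thesis
  proof cases
    case 1
    have *: "u \<in> Z \<longleftrightarrow> v \<notin> Z" if "dst u v = 1" for u v
    proof (rule code_distance_2_bipartite[OF D3 xyZ])
      show "dst y z \<noteq> 1" if "y \<in> Z" "z \<in> Z" for y z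
        using Z_min[OF that] 1 by (cases "y = z") auto
    qed (use xy 1 Z_closed that in auto)
    \<comment> \<open>A codeword outside \<open>Z\<close> would have its neighbours in
      \<open>Z\<close>, against minimum distance 2.\<close>
    have "Z = Y"
    proof (rule ccontr)
      assume "Z \<noteq> Y"
      then obtain u where u: "u \<in> Y" "u \<notin> Z" using ZY by blast
      obtain v where v: "dst u v = 1" using ex_dst[OF D_pos] by blast
      then have "v \<in> Y" "v \<noteq> u" using * u ZY by auto
      then show False using min[of u v] u v 1 by simp
    qed
    then have "bipartite_half (R 1) Y"
      using * Y xy unfolding bipartite_half_def by (auto simp: dst_eq_1[unfolded One_nat_def])
    then show ?thesis ..
  next
    case 2
    then have "valency = 2"
      using code_middle_distance_valency_2[OF xyZ xy(3)] Z_min Z_closed by blast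
    then show ?thesis using nc valency_2_imp_cycle by blast
  next
    case 3
    have "dst x z = D" if "z \<in> Y" "z \<noteq> x" for z
      using min[of x z] that xy 3 dst_le[of x z] by simp
    moreover have "z \<in> Y" if "dst x z = D" for z
      using closed[OF xy(1,2)] xy(3) 3 that by simp
    ultimately have "Y = {z. z = x \<or> dst x z = D}" using xy(1) by blast
    moreover have "u = w \<or> dst u w = D" if uvw: "dst u v = D" "dst v w = D" for u v w
    proof -
      \<comment> \<open>The triple is moved onto the codewords \<open>y\<close>, \<open>x\<close>;
        the third vertex then lies in \<open>Y\<close>, where the only distances are 0 and
        \<open>D\<close>.\<close>
      obtain z where z: "dst y z = dst u w" "dst z x = D"
        by (rule dst_transfer[of u v y x w "dst u w" D])
          (use uvw xy 3 dst_sym[of v w] dst_sym[of x y] in simp_all)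
      then have "z \<in> Y" using closed[OF xy(1,2)] xy 3 dst_sym[of x z] by simp
      then show ?thesis 
        using min[of y z] xy 3 z dst_le[of u w] dst_eq_0[of y z] dst_eq_0[of u w] by auto
    qed
    ultimately show ?thesis by blast
  qed
qed

end

subsection \<open>Bose--Mesner algebra and primitive idempotents\<close>

lemma mmult_assoc: "mmult (mmult A B) C = mmult A (mmult B C)"
proof (intro ext)
  fix x y
  have "mmult (mmult A B) C x y = (\<Sum>z\<in>UNIV. \<Sum>w\<in>UNIV. A x w * B w z * C z y)"
    by (simp add: mmult_def sum_distrib_right)
  also have "\<dots> = (\<Sum>w\<in>UNIV. \<Sum>z\<in>UNIV. A x w * B w z * C z y)" by (rule sum.swap)
  also have "\<dots> = mmult A (mmult B C) x y" by (simp add: mmult_def sum_distrib_left mult.assoc)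
  finally show "mmult (mmult A B) C x y = mmult A (mmult B C) x y" .
qed

lemma mvec_mmult: "mvec (mmult A B) v = mvec A (mvec B v)"
proof
  fix x
  have "mvec (mmult A B) v x = (\<Sum>z\<in>UNIV. \<Sum>w\<in>UNIV. A x w * B w z * v z)"
    by (simp add: mvec_def mmult_def sum_distrib_right)
  also have "\<dots> = (\<Sum>w\<in>UNIV. \<Sum>z\<in>UNIV. A x w * B w z * v z)" by (rule sum.swap)
  also have "\<dots> = mvec A (mvec B v) x" by (simp add: mvec_def sum_distrib_left mult.assoc)
  finally show "mvec (mmult A B) v x = mvec A (mvec B v) x" .
qed

lemma mmult_scale_right: "mmult A (\<lambda>x y. c * B x y) = (\<lambda>x y. c * mmult A B x y)"
  by (simp add: mmult_def sum_distrib_left mult_ac)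

lemma mmult_sum_left:
  "mmult (\<lambda>x y. \<Sum>j\<in>J. \<beta> j * F j x y) B = (\<lambda>x y. \<Sum>j\<in>J. \<beta> j * mmult (F j) B x y)"
proof (intro ext)
  fix x y
  have "mmult (\<lambda>x y. \<Sum>j\<in>J. \<beta> j * F j x y) B x y = (\<Sum>z\<in>UNIV. \<Sum>j\<in>J. \<beta> j * F j x z * B z y)"
    by (simp add: mmult_def sum_distrib_right)
  also have "\<dots> = (\<Sum>j\<in>J. \<Sum>z\<in>UNIV. \<beta> j * F j x z * B z y)" by (rule sum.swap)
  also have "\<dots> = (\<Sum>j\<in>J. \<beta> j * mmult (F j) B x y)"
    by (simp add: mmult_def sum_distrib_left mult.assoc)
  finally show "mmult (\<lambda>x y. \<Sum>j\<in>J. \<beta> j * F j x y) B x y = (\<Sum>j\<in>J. \<beta> j * mmult (F j) B x y)" .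
qed

lemma mvec_scale_mat: "mvec (\<lambda>x y. c * B x y) v = (\<lambda>x. c * mvec B v x)"
  by (simp add: mvec_def sum_distrib_left mult.assoc)

lemma sum_mult_cnj_eq_0:
  fixes f :: "'a::finite \<Rightarrow> complex"
  assumes "(\<Sum>y\<in>UNIV. f y * cnj (f y)) = 0"
  shows "f y = 0"
proof -
  have "complex_of_real (\<Sum>y\<in>UNIV. (cmod (f y))\<^sup>2) = (\<Sum>y\<in>UNIV. f y * cnj (f y))"
    by (simp only: of_real_sum complex_norm_square)
  with assms have "(\<Sum>y\<in>UNIV. (cmod (f y))\<^sup>2) = 0" by (metis of_real_eq_0_iff)
  then show ?thesis by (simp add: sum_nonneg_eq_0_iff)
qed

lemma sum_mvec_symmetric:
  assumes "\<And>x y. A x y = A y x"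
  shows "(\<Sum>y\<in>UNIV. mvec A g y * h y) = (\<Sum>y\<in>UNIV. g y * mvec A h y)"
proof -
  have "(\<Sum>y\<in>UNIV. mvec A g y * h y) = (\<Sum>y\<in>UNIV. \<Sum>z\<in>UNIV. A y z * g z * h y)"
    by (simp add: mvec_def sum_distrib_right)
  also have "\<dots> = (\<Sum>z\<in>UNIV. \<Sum>y\<in>UNIV. A y z * g z * h y)" by (rule sum.swap)
  also have "\<dots> = (\<Sum>z\<in>UNIV. \<Sum>y\<in>UNIV. g z * (A z y * h y))"
    by (intro sum.cong refl) (subst assms, simp add: mult_ac)
  finally show ?thesis by (simp add: mvec_def sum_distrib_left)
qed

context metric_assoc_scheme
begin

text \<open>Grouping \<open>z\<close> by its two distances expresses the sum through intersection
  numbers; this is what closes the Bose-Mesner algebra under products.\<close>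

lemma sum_dst_cong:
  fixes f :: "nat \<Rightarrow> nat \<Rightarrow> complex"
  assumes "dst x y = dst x' y'"
  shows "(\<Sum>z\<in>UNIV. f (dst x z) (dst z y)) = (\<Sum>z\<in>UNIV. f (dst x' z) (dst z y'))"
proof -
  have "(\<Sum>z\<in>UNIV. f (dst u z) (dst z v)) =
    (\<Sum>(i, j)\<in>{..D} \<times> {..D}. of_nat (card {z. dst u z = i \<and> dst z v = j}) * f i j)" for u v
  proof -
    have "(\<Sum>z\<in>UNIV. f (dst u z) (dst z v)) =
      (\<Sum>p\<in>{..D} \<times> {..D}. \<Sum>z | z \<in> UNIV \<and> (dst u z, dst z v) = p. f (dst u z) (dst z v))"
      by (rule sum.group[symmetric]) (auto simp: dst_le)
    also have "\<dots> = (\<Sum>(i, j)\<in>{..D} \<times> {..D}. of_nat (card {z. dst u z = i \<and> dst z v = j}) * f i j)"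
    proof (intro sum.cong refl, clarify)
      fix i j
      have "(\<Sum>z | z \<in> UNIV \<and> (dst u z, dst z v) = (i, j). f (dst u z) (dst z v)) =
        (\<Sum>z | dst u z = i \<and> dst z v = j. f i j)"
        by (rule sum.cong) auto
      then show "(\<Sum>z | z \<in> UNIV \<and> (dst u z, dst z v) = (i, j). f (dst u z) (dst z v)) =
        of_nat (card {z. dst u z = i \<and> dst z v = j}) * f i j" by simp
    qed
    finally show ?thesis .
  qed
  then show ?thesis using card_dst_cong[OF assms] by simp
qed

abbreviation "M \<equiv> bose_mesner D R"

lemma M_iff: "B \<in> M \<longleftrightarrow> (\<exists>c. B = (\<lambda>x y. c (dst x y)))"
proof -
  have "(\<Sum>i\<le>D. c i * adj (R i) x y) = c (dst x y)" for c :: "nat \<Rightarrow> complex" and x y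
  proof -
    have "(\<Sum>i\<le>D. c i * adj (R i) x y) = (\<Sum>i\<le>D. if dst x y = i then c i else 0)"
      by (rule sum.cong) (auto simp: adj_def R_iff)
    then show ?thesis by (simp add: dst_le)
  qed
  then show ?thesis by (simp add: bose_mesner_def)
qed

lemma M_dst [intro]: "(\<lambda>x y. c (dst x y)) \<in> M"
  by (auto simp: M_iff)

lemma M_cong: "B \<in> M \<Longrightarrow> dst x y = dst x' y' \<Longrightarrow> B x y = B x' y'"
  by (auto simp: M_iff)

lemma M_sym: "B \<in> M \<Longrightarrow> B x y = B y x"
  by (rule M_cong) (auto intro: dst_sym)

lemma M_I:
  assumes "\<And>x y x' y'. dst x y = dst x' y' \<Longrightarrow> B x y = B x' y'"
  shows "B \<in> M"
proof -
  define c where "c i = (case SOME p. dst (fst p) (snd p) = i of (x, y) \<Rightarrow> B x y)" for i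
  have "B x y = c (dst x y)" for x y
  proof -
    let ?p = "SOME p. dst (fst p) (snd p) = dst x y"
    have "dst (fst ?p) (snd ?p) = dst x y"
      by (rule someI[of "\<lambda>p. dst (fst p) (snd p) = dst x y" "(x, y)"]) simp
    from assms[OF this] show ?thesis by (simp add: c_def case_prod_beta)
  qed
  then show ?thesis by (auto simp: M_iff fun_eq_iff)
qed

lemma M_mmult: assumes "A \<in> M" "B \<in> M" shows "mmult A B \<in> M"
proof -
  obtain a b where ab: "A = (\<lambda>x y. a (dst x y))" "B = (\<lambda>x y. b (dst x y))"
    using assms by (auto simp: M_iff)
  show ?thesis
    unfolding ab mmult_def by (rule M_I) (rule sum_dst_cong[of _ _ _ _ "\<lambda>i j. a i * b j"])
qed

text \<open>A product in \<open>M\<close> is again symmetric, and transposing a product of symmetric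
  matrices reverses it.\<close>

lemma M_commute: assumes "A \<in> M" "B \<in> M" shows "mmult A B = mmult B A"
proof (intro ext)
  fix x y
  have "mmult A B x y = mmult A B y x" using assms by (intro M_sym M_mmult)
  also have "\<dots> = (\<Sum>z\<in>UNIV. B x z * A z y)"
    unfolding mmult_def using M_sym[OF assms(1)] M_sym[OF assms(2)]
    by (intro sum.cong refl) (metis mult.commute)
  finally show "mmult A B x y = mmult B A x y" by (simp add: mmult_def)
qed

lemma adj_eq: "i \<le> D \<Longrightarrow> adj (R i) = (\<lambda>x y. if dst x y = i then 1 else 0)"
  by (auto simp: adj_def R_iff fun_eq_iff)

lemma M_adj: "i \<le> D \<Longrightarrow> adj (R i) \<in> M"
  unfolding adj_eq by (rule M_dst[of "\<lambda>k. if k = i then 1 else 0"])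

end

section \<open>Primitive idempotents and the cometric property\<close>

locale pq_scheme = metric_assoc_scheme D R
  for D and R :: "nat \<Rightarrow> ('x::finite \<times> 'x) set" +
  fixes E :: "nat \<Rightarrow> 'x::finite cmat"
  assumes idem: "primitive_idempotents D R E" and comet: "cometric D E"
begin

lemma E_primitive: "j \<le> D \<Longrightarrow> primitive_idempotent M (E j)"
  using idem unfolding primitive_idempotents_def by blast

lemma E_M: "j \<le> D \<Longrightarrow> E j \<in> M"
  and E_idem: "j \<le> D \<Longrightarrow> mmult (E j) (E j) = E j"
  and E_nz: "j \<le> D \<Longrightarrow> E j \<noteq> zmat"
  using E_primitive unfolding primitive_idempotent_def by blast+

lemma E_min: "j \<le> D \<Longrightarrow> F \<in> M \<Longrightarrow> mmult F F = F \<Longrightarrow> mmult F (E j) = F \<Longrightarrow> F = zmat \<or> F = E j"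
  using E_primitive unfolding primitive_idempotent_def by blast

text \<open>The product is an idempotent below both factors, so if nonzero it equals both of them by
  minimality.\<close>

lemma E_orth:
  assumes ij: "i \<le> D" "j \<le> D" "i \<noteq> j"
  shows "mmult (E i) (E j) = zmat"
proof (rule ccontr)
  let ?F = "mmult (E i) (E j)"
  assume nz: "?F \<noteq> zmat"
  have F: "?F \<in> M" using ij by (intro M_mmult E_M)
  have com: "?F = mmult (E j) (E i)" using ij by (intro M_commute E_M)
  have Fj: "mmult ?F (E j) = ?F" using ij by (simp add: mmult_assoc E_idem)
  have Fi: "mmult ?F (E i) = ?F" using ij unfolding com by (simp add: mmult_assoc E_idem)
  have "mmult ?F ?F = mmult (mmult ?F (E i)) (E j)" by (simp add: mmult_assoc)
  then have FF: "mmult ?F ?F = ?F" by (simp only: Fi Fj)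
  have "?F = E j" "?F = E i" using E_min[OF _ F FF] Fi Fj nz ij by blast+
  then have "E i = E j" by simp
  then show False using idem ij unfolding primitive_idempotents_def inj_on_def by auto
qed

text \<open>Dimension count: the \<open>D + 1\<close> idempotents are independent, being orthogonal,
  and \<open>D + 1\<close> adjacency matrices span \<open>M\<close>.\<close>

lemma M_span:
  assumes B: "B \<in> M"
  shows "\<exists>\<beta>. B = (\<lambda>x y. \<Sum>j\<le>D. \<beta> j * E j x y)"
proof -
  \<comment> \<open>Matrices are uncurried to functions on pairs so that the vector space
    interpretation applies.\<close>
  define uc :: "'x cmat \<Rightarrow> 'x \<times> 'x \<Rightarrow> complex" where "uc F = (\<lambda>(x, y). F x y)" for F
  have uc_eq: "uc F = uc G \<longleftrightarrow> F = G" for F G by (auto simp: uc_def fun_eq_iff)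
  have inj: "inj_on (\<lambda>j. uc (E j)) {..D}"
    using idem by (auto simp: inj_on_def uc_eq primitive_idempotents_def)
  let ?BE = "(\<lambda>j. uc (E j)) ` {..D}"
  let ?AA = "(\<lambda>i. uc (adj (R i))) ` {..D}"
  have sumE: "(\<Sum>v\<in>?BE. cscale (f v) v) = uc (\<lambda>x y. \<Sum>j\<le>D. f (uc (E j)) * E j x y)" for f
    by (subst sum.reindex[OF inj]) (auto simp: fun_eq_iff sum_fun_apply uc_def cscale_def)
  have indep: "cfun.independent ?BE"
  proof (rule cfun.independent_if_scalars_zero)
    fix f v assume "(\<Sum>v\<in>?BE. cscale (f v) v) = 0" and "v \<in> ?BE"
    then obtain k where k: "k \<le> D" "v = uc (E k)" by auto
    have "uc (\<lambda>x y. \<Sum>j\<le>D. f (uc (E j)) * E j x y) = uc zmat"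
      using \<open>_ = 0\<close> unfolding sumE by (auto simp: uc_def zmat_def fun_eq_iff)
    then have 0: "(\<lambda>x y. \<Sum>j\<le>D. f (uc (E j)) * E j x y) = zmat" by (simp only: uc_eq)
    obtain x y where xy: "E k x y \<noteq> 0" using E_nz[OF k(1)] by (auto simp: zmat_def fun_eq_iff)
    have "0 = mmult (\<lambda>x y. \<Sum>j\<le>D. f (uc (E j)) * E j x y) (E k) x y"
      unfolding 0 by (simp add: mmult_def zmat_def)
    also have "\<dots> = (\<Sum>j\<le>D. if j = k then f (uc (E k)) * E k x y else 0)"
      unfolding mmult_sum_left using k E_idem E_orth by (intro sum.cong) (auto simp: zmat_def)
    finally show "f v = 0" using k xy by simp
  qed simp
  have "uc ` M \<subseteq> cfun.span ?AA"
  proof clarify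
    fix F assume "F \<in> M"
    then obtain c where "F = (\<lambda>x y. \<Sum>i\<le>D. c i * adj (R i) x y)" by (auto simp: bose_mesner_def)
    then have "uc F = (\<Sum>i\<le>D. cscale (c i) (uc (adj (R i))))"
      by (auto simp: fun_eq_iff sum_fun_apply uc_def cscale_def)
    also have "\<dots> \<in> cfun.span ?AA"
      by (intro cfun.span_sum cfun.span_scale cfun.span_base) simp
    finally show "uc F \<in> cfun.span ?AA" .
  qed
  then have "cfun.dim (uc ` M) \<le> card ?AA" by (rule cfun.dim_le_card) simp
  also have "\<dots> \<le> card ?BE" using card_image_le[of "{..D}" "\<lambda>i. uc (adj (R i))"] card_image[OF inj] by simp
  finally have "uc ` M \<subseteq> cfun.span ?BE"
    using indep by (intro cfun.card_ge_dim_independent) (auto simp: E_M)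
  then have "uc B \<in> range (\<lambda>u. \<Sum>v\<in>?BE. cscale (u v) v)"
    using B cfun.span_finite[of ?BE] by auto
  then obtain u where "uc B = uc (\<lambda>x y. \<Sum>j\<le>D. u (uc (E j)) * E j x y)"
    unfolding sumE by blast
  then show ?thesis unfolding uc_eq by (rule exI[of _ "\<lambda>j. u (uc (E j))"])
qed

lemma mmult_span_E:
  "k \<le> D \<Longrightarrow> mmult (\<lambda>x y. \<Sum>j\<le>D. \<beta> j * E j x y) (E k) = (\<lambda>x y. \<beta> k * E k x y)"
proof (intro ext)
  fix x y assume k: "k \<le> D"
  have "mmult (\<lambda>x y. \<Sum>j\<le>D. \<beta> j * E j x y) (E k) x y = (\<Sum>j\<le>D. if j = k then \<beta> k * E k x y else 0)"
    unfolding mmult_sum_left using k E_idem E_orth by (intro sum.cong) (auto simp: zmat_def)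
  then show "mmult (\<lambda>x y. \<Sum>j\<le>D. \<beta> j * E j x y) (E k) x y = \<beta> k * E k x y" using k by simp
qed

lemma M_eigen:
  assumes "B \<in> M" "k \<le> D"
  obtains \<theta> where "mmult B (E k) = (\<lambda>x y. \<theta> * E k x y)"
proof -
  obtain \<beta> where "B = (\<lambda>x y. \<Sum>j\<le>D. \<beta> j * E j x y)" using M_span[OF assms(1)] by blast
  then have "mmult B (E k) = (\<lambda>x y. \<beta> k * E k x y)" by (simp only: mmult_span_E[OF assms(2)])
  then show ?thesis by (rule that)
qed

lemma sum_E: "(\<Sum>j\<le>D. E j x y) = (if x = y then 1 else 0)"
proof -
  let ?I = "\<lambda>x y. if dst x y = 0 then 1 else 0 :: complex"
  have "?I \<in> M" by (rule M_dst[of "\<lambda>k. if k = 0 then 1 else 0"])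
  then obtain \<beta> where \<beta>: "?I = (\<lambda>x y. \<Sum>j\<le>D. \<beta> j * E j x y)" using M_span by blast
  have "\<beta> k = 1" if k: "k \<le> D" for k
  proof -
    obtain x y where xy: "E k x y \<noteq> 0" using E_nz[OF k] by (auto simp: zmat_def fun_eq_iff)
    have "mmult ?I (E k) x y = (\<Sum>z\<in>UNIV. if x = z then E k z y else 0)"
      unfolding mmult_def by (intro sum.cong) (auto simp: dst_eq_0)
    then have "mmult ?I (E k) x y = E k x y" by simp
    moreover have "mmult ?I (E k) x y = \<beta> k * E k x y"
      unfolding \<beta> by (simp add: mmult_span_E[OF k])
    ultimately show ?thesis using xy by simp
  qed
  then have "(\<Sum>j\<le>D. E j x y) = (\<Sum>j\<le>D. \<beta> j * E j x y)" by simp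
  also have "\<dots> = ?I x y" using fun_cong[OF fun_cong[OF \<beta>], of x y] by simp
  finally show ?thesis by (simp add: dst_eq_0)
qed

lemma E_sym: "j \<le> D \<Longrightarrow> E j x y = E j y x"
  by (intro M_sym E_M)

lemma E_mult: "i \<le> D \<Longrightarrow> j \<le> D \<Longrightarrow> (\<Sum>z\<in>UNIV. E i x z * E j z y) = (if i = j then E i x y else 0)"
  using E_idem[of i] E_orth[of i j] by (auto simp: mmult_def zmat_def dest: fun_cong)

text \<open>The conjugate F of \<open>E j\<close> is an idempotent of \<open>M\<close>, so F times
  \<open>E j\<close> is \<theta> times \<open>E j\<close>. Its diagonal entries are squared norms of
  columns, hence \<theta> is nonzero, and idempotence gives \<theta> = 1. Conjugating the resulting
  identity shows that the same product is also F.\<close>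

lemma E_real: assumes j: "j \<le> D" shows "cnj (E j x y) = E j x y"
proof -
  let ?F = "\<lambda>x y. cnj (E j x y)"
  have F: "?F \<in> M" using M_cong[OF E_M[OF j]] by (intro M_I) metis
  have FF: "mmult ?F ?F = ?F"
    using E_idem[OF j] by (auto simp: mmult_def fun_eq_iff simp flip: complex_cnj_mult cnj_sum)
  obtain \<theta> where \<theta>: "mmult ?F (E j) = (\<lambda>x y. \<theta> * E j x y)" using M_eigen[OF F j] by blast
  obtain u v where uv: "E j u v \<noteq> 0" using E_nz[OF j] by (auto simp: zmat_def fun_eq_iff)
  have "mmult ?F (E j) v v = (\<Sum>z\<in>UNIV. E j z v * cnj (E j z v))"
    unfolding mmult_def using E_sym[OF j] by (intro sum.cong refl) (metis mult.commute)
  then have nz: "\<theta> * E j v v \<noteq> 0"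
    using sum_mult_cnj_eq_0[of "\<lambda>z. E j z v" u] uv \<theta> by metis
  have "mmult ?F (mmult ?F (E j)) = mmult ?F (E j)" by (simp only: mmult_assoc[symmetric] FF)
  then have "\<theta> * (\<theta> * E j v v) = \<theta> * E j v v"
    unfolding \<theta> mmult_scale_right by (metis (no_types, lifting))
  with nz have "\<theta> = 1" by simp
  with \<theta> have 1: "mmult ?F (E j) = E j" by simp
  then have "mmult (E j) ?F = E j" using M_commute[OF F E_M[OF j]] by simp
  then have "(\<lambda>x y. cnj (mmult (E j) ?F x y)) = ?F" by simp
  moreover have "(\<lambda>x y. cnj (mmult (E j) ?F x y)) = mmult ?F (E j)" by (simp add: mmult_def)
  ultimately have "?F = E j" using 1 by simp
  then show ?thesis by metis
qed

text \<open>For a real symmetric idempotent a diagonal entry is the squared norm of a column, and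
  the diagonal is constant.\<close>

lemma E_diag_nz: assumes j: "j \<le> D" shows "E j x x \<noteq> 0"
proof
  assume 0: "E j x x = 0"
  have "E j u v = 0" for u v
  proof -
    have "E j v v = 0" using M_cong[OF E_M[OF j], of x x v v] 0 by simp
    then have "(\<Sum>z\<in>UNIV. E j v z * E j z v) = 0" using E_mult[OF j j, of v v] by simp
    moreover have "(\<Sum>z\<in>UNIV. E j z v * cnj (E j z v)) = (\<Sum>z\<in>UNIV. E j v z * E j z v)"
      using E_sym[OF j] E_real[OF j] by (intro sum.cong refl) metis
    ultimately have "(\<Sum>z\<in>UNIV. E j z v * cnj (E j z v)) = 0" by simp
    then show ?thesis by (rule sum_mult_cnj_eq_0)
  qed
  then show False using E_nz[OF j] by (auto simp: zmat_def fun_eq_iff)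
qed

lemma E_poly: "j \<le> D \<Longrightarrow> \<exists>p. degree p = j \<and> (\<forall>x y. E j x y = poly p (E 1 x y))"
  using comet unfolding cometric_def by metis

text \<open>Every matrix of \<open>M\<close> is a combination of the \<open>E j\<close>, hence
  entrywise a polynomial in \<open>E 1\<close>; this is applied to the distance matrix
  itself.\<close>

lemma E1_separates: "E 1 x y = E 1 x' y' \<Longrightarrow> dst x y = dst x' y'"
proof -
  assume eq: "E 1 x y = E 1 x' y'"
  have Ej: "E j x y = E j x' y'" if "j \<le> D" for j using E_poly[OF that] eq by metis
  obtain \<beta> where "(\<lambda>x y. of_nat (dst x y)) = (\<lambda>x y. \<Sum>j\<le>D. \<beta> j * E j x y)"
    using M_span[OF M_dst[of of_nat]] by blast
  then have *: "of_nat (dst u v) = (\<Sum>j\<le>D. \<beta> j * E j u v)" for u v by metis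
  have "(of_nat (dst x y) :: complex) = of_nat (dst x' y')" unfolding * by (simp add: Ej)
  then show ?thesis by simp
qed

text \<open>Each \<open>E m\<close> with \<open>m < i\<close> is a polynomial of degree
  \<open>m\<close> in \<open>E 1\<close> and orthogonal to \<open>E i\<close> for the entrywise
  inner product, so the induction can strip off one leading term at a time.\<close>

lemma sum_poly_E1_E:
  assumes i: "i \<le> D"
  shows "degree p < i \<Longrightarrow> (\<Sum>y\<in>UNIV. \<Sum>z\<in>UNIV. poly p (E 1 y z) * E i y z) = 0"
proof (induction "degree p" arbitrary: p rule: less_induct)
  case less
  define m where "m = degree p"
  have m: "m < i" "m \<le> D" using less.prems i by (auto simp: m_def)
  obtain q where q: "degree q = m" "\<And>x y. E m x y = poly q (E 1 x y)" using E_poly m by metis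
  have "q \<noteq> 0" using q(2) E_nz[OF m(2)] by (auto simp: zmat_def fun_eq_iff)
  then have qm: "coeff q m \<noteq> 0" using q(1) leading_coeff_0_iff[of q] by auto
  define c where "c = coeff p m / coeff q m"
  define r where "r = p - smult c q"
  have orth: "(\<Sum>y\<in>UNIV. \<Sum>z\<in>UNIV. E m y z * E i y z) = 0"
  proof -
    have "(\<Sum>z\<in>UNIV. E m y z * E i y z) = 0" for y
    proof -
      have "(\<Sum>z\<in>UNIV. E m y z * E i y z) = (\<Sum>z\<in>UNIV. E m y z * E i z y)"
        using E_sym[OF i] by (intro sum.cong refl) metis
      then show ?thesis using E_mult[OF m(2) i, of y y] m by simp
    qed
    then show ?thesis by simp
  qed
  have r: "(\<Sum>y\<in>UNIV. \<Sum>z\<in>UNIV. poly r (E 1 y z) * E i y z) = 0"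
  proof (cases "r = 0")
    case False
    have "coeff r m = 0" using qm by (simp add: r_def c_def)
    moreover have "degree r \<le> m" unfolding r_def
      using degree_smult_le[of c q] q(1) by (intro degree_diff_le) (auto simp: m_def)
    ultimately have "degree r < degree p"
      using False m_def by (metis le_neq_implies_less leading_coeff_0_iff)
    then show ?thesis using less by simp
  qed simp
  have "poly p (E 1 y z) = poly r (E 1 y z) + c * E m y z" for y z by (simp add: r_def q(2))
  then have "(\<Sum>y\<in>UNIV. \<Sum>z\<in>UNIV. poly p (E 1 y z) * E i y z)
    = (\<Sum>y\<in>UNIV. \<Sum>z\<in>UNIV. poly r (E 1 y z) * E i y z) + c * (\<Sum>y\<in>UNIV. \<Sum>z\<in>UNIV. E m y z * E i y z)"
    by (simp add: algebra_simps sum.distrib sum_distrib_left)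
  then show ?case using r orth by simp
qed

text \<open>Up to a positive factor this is a Krein parameter. It vanishes because the entrywise
  product of \<open>E 1\<close> and \<open>E i\<close> has degree at most \<open>i + 1\<close> in
  \<open>E 1\<close>.\<close>

lemma krein_triple_sum_0:
  assumes ij: "i \<le> D" "j \<le> D" "i + 1 < j \<or> j + 1 < i"
  shows "(\<Sum>y\<in>UNIV. \<Sum>z\<in>UNIV. E 1 y z * E i y z * E j y z) = 0"
proof -
  have *: "(\<Sum>y\<in>UNIV. \<Sum>z\<in>UNIV. E 1 y z * E i y z * E j y z) = 0"
    if ij: "i \<le> D" "j \<le> D" "i + 1 < j" for i j
  proof -
    obtain p where p: "degree p = i" "\<And>x y. E i x y = poly p (E 1 x y)" using E_poly[OF ij(1)] by metis
    have "degree (pCons 0 p) < j" using ij p degree_pCons_le[of 0 p] by linarith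
    from sum_poly_E1_E[OF ij(2) this] show ?thesis by (simp add: p(2))
  qed
  from ij(3) show ?thesis
  proof
    assume "j + 1 < i"
    from *[OF ij(2,1) this] show ?thesis by (simp add: mult_ac)
  qed (use * ij in blast)
qed

text \<open>The squared norm of the operator in question is a positive multiple of a Krein parameter.\<close>

lemma E_dual_tridiagonal:
  assumes ij: "i \<le> D" "j \<le> D" "i + 1 < j \<or> j + 1 < i"
  shows "mvec (E i) (\<lambda>y. E 1 x y * mvec (E j) v y) = zvec"
proof -
  have D1: "1 \<le> D" by (rule D_pos)
  \<comment> \<open>Up to the factor |X|, \<open>N\<close> is the product of \<open>E i\<close>,
    \<open>astar E 1 x\<close> and \<open>E j\<close>. Its entries are real, so it is enough that
    their squares sum to zero; this sum will be the \<open>x\<close>, \<open>x\<close> entry of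
    \<open>E 1\<close> times \<open>H\<close> times \<open>E 1\<close>.\<close>
  define g where "g z u = E 1 x u * E j u z" for z u
  define N where "N y z = mvec (E i) (g z) y" for y z
  define H where "H y z = E i y z * E j y z" for y z
  have H: "H \<in> M" unfolding H_def using M_cong[OF E_M[OF ij(1)]] M_cong[OF E_M[OF ij(2)]]
    by (intro M_I) metis
  \<comment> \<open>All diagonal entries agree, and the trace is the vanishing triple sum.\<close>
  have "mmult H (E 1) x x = 0"
  proof -
    have "mmult H (E 1) w w = mmult H (E 1) x x" for w
      by (rule M_cong[OF M_mmult[OF H E_M[OF D1]]]) simp
    then have "(\<Sum>w\<in>UNIV. mmult H (E 1) w w) = (\<Sum>w\<in>(UNIV :: 'x set). mmult H (E 1) x x)"
      by (intro sum.cong refl)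
    then have "of_nat (card (UNIV :: 'x set)) * mmult H (E 1) x x = (\<Sum>w\<in>UNIV. mmult H (E 1) w w)"
      by simp
    also have "\<dots> = (\<Sum>y\<in>UNIV. \<Sum>z\<in>UNIV. E 1 y z * E i y z * E j y z)"
      unfolding mmult_def H_def using E_sym[OF D1] by (intro sum.cong refl) (metis mult.assoc mult.commute)
    also have "\<dots> = 0" by (rule krein_triple_sum_0[OF ij])
    finally show ?thesis by simp
  qed
  moreover have "mmult (E 1) (mmult H (E 1)) = mmult H (E 1)"
    by (metis E_M E_idem D1 H M_commute mmult_assoc)
  ultimately have 0: "mmult (E 1) (mmult H (E 1)) x x = 0" by simp
  have Ei: "mvec (E i) (mvec (E i) f) = mvec (E i) f" for f
    by (simp add: mvec_mmult[symmetric] E_idem ij)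
  have col: "(\<Sum>y\<in>UNIV. N y z * N y z) = (\<Sum>u\<in>UNIV. \<Sum>v\<in>UNIV. g z u * E i u v * g z v)" for z
    unfolding N_def by (subst sum_mvec_symmetric[OF E_sym[OF ij(1)]], unfold Ei)
      (simp add: mvec_def sum_distrib_left mult.assoc)
  have "(\<Sum>z\<in>UNIV. \<Sum>y\<in>UNIV. N y z * N y z)
      = (\<Sum>u\<in>UNIV. \<Sum>v\<in>UNIV. \<Sum>z\<in>UNIV. g z u * E i u v * g z v)"
    unfolding col by (subst sum.swap, rule sum.cong[OF refl], rule sum.swap)
  also have "\<dots> = (\<Sum>u\<in>UNIV. \<Sum>v\<in>UNIV. E 1 x u * (H u v * E 1 v x))"
  proof (intro sum.cong refl)
    fix u v
    have "g z v = E 1 x v * E j z v" for z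
      using E_sym[OF ij(2), of v z] by (simp add: g_def)
    then have "(\<Sum>z\<in>UNIV. g z u * E i u v * g z v) = E 1 x u * E i u v * E 1 x v * (\<Sum>z\<in>UNIV. E j u z * E j z v)"
      unfolding sum_distrib_left by (intro sum.cong refl) (simp add: g_def[of _ u] mult_ac)
    then show "(\<Sum>z\<in>UNIV. g z u * E i u v * g z v) = E 1 x u * (H u v * E 1 v x)"
      using E_sym[OF D1, of v x] by (simp add: E_mult ij H_def)
  qed
  also have "\<dots> = mmult (E 1) (mmult H (E 1)) x x"
    by (simp add: mmult_def sum_distrib_left)
  finally have "(\<Sum>z\<in>UNIV. \<Sum>y\<in>UNIV. N y z * N y z) = 0" using 0 by simp
  moreover have "cnj (N y z) = N y z" for y z
    by (simp add: N_def mvec_def g_def E_real ij D1[unfolded One_nat_def])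
  ultimately have "(\<Sum>p\<in>UNIV. N (snd p) (fst p) * cnj (N (snd p) (fst p))) = 0"
    by (simp add: sum.cartesian_product case_prod_beta)
  from sum_mult_cnj_eq_0[OF this] have N0: "N y z = 0" for y z by (metis fst_conv snd_conv)
  show ?thesis
  proof
    fix y
    have "mvec (E i) (\<lambda>y. E 1 x y * mvec (E j) v y) y = (\<Sum>u\<in>UNIV. \<Sum>z\<in>UNIV. E i y u * g z u * v z)"
      by (simp add: mvec_def g_def sum_distrib_left mult.assoc)
    also have "\<dots> = (\<Sum>z\<in>UNIV. N y z * v z)"
      by (subst sum.swap) (simp add: N_def mvec_def sum_distrib_right)
    finally show "mvec (E i) (\<lambda>y. E 1 x y * mvec (E j) v y) y = zvec y" by (simp add: N0 zvec_def)
  qed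
qed

end

subsection \<open>Terwilliger modules\<close>

lemma cinner_sum_right: "cinner u (\<lambda>y. \<Sum>i\<in>I. f i y) = (\<Sum>i\<in>I. cinner u (f i))"
proof -
  have "cinner u (\<lambda>y. \<Sum>i\<in>I. f i y) = (\<Sum>y\<in>UNIV. \<Sum>i\<in>I. u y * cnj (f i y))"
    by (simp add: cinner_def sum_distrib_left)
  also have "\<dots> = (\<Sum>i\<in>I. \<Sum>y\<in>UNIV. u y * cnj (f i y))" by (rule sum.swap)
  finally show ?thesis by (simp add: cinner_def)
qed

lemma cinner_add_left: "cinner (\<lambda>y. u y + v y) w = cinner u w + cinner v w"
  by (simp add: cinner_def algebra_simps sum.distrib)

lemma cinner_add_right: "cinner u (\<lambda>y. v y + w y) = cinner u v + cinner u w"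
  by (simp add: cinner_def algebra_simps sum.distrib)

lemma cinner_scale_left: "cinner (\<lambda>y. c * v y) w = c * cinner v w"
  by (simp add: cinner_def sum_distrib_left mult.assoc)

lemma cinner_scale_right: "cinner v (\<lambda>y. c * w y) = cnj c * cinner v w"
  by (simp add: cinner_def sum_distrib_left mult_ac)

lemma cinner_diff_scale_left: "cinner (\<lambda>y. u y - c * v y) w = cinner u w - c * cinner v w"
  by (simp add: cinner_def algebra_simps sum_subtractf sum_distrib_left)

lemma cinner_zvec [simp]: "cinner zvec w = 0" "cinner u zvec = 0"
  by (simp_all add: cinner_def zvec_def)

lemma cinner_cnj: "cnj (cinner u v) = cinner v u"
  by (simp add: cinner_def mult.commute)

lemma cinner_self_eq_0: "cinner u u = 0 \<Longrightarrow> u = zvec"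
  using sum_mult_cnj_eq_0[of u] by (auto simp: cinner_def zvec_def)

lemma cinner_mvec:
  assumes "\<And>x y. B x y = B y x" "\<And>x y. cnj (B x y) = B x y"
  shows "cinner (mvec B u) v = cinner u (mvec B v)"
  using sum_mvec_symmetric[of B u "\<lambda>y. cnj (v y)", OF assms(1)]
  by (simp add: cinner_def mvec_def assms(2))

lemma cinner_diag:
  assumes "\<And>y. cnj (c y) = c y"
  shows "cinner (\<lambda>y. c y * u y) v = cinner u (\<lambda>y. c y * v y)"
  by (simp add: cinner_def assms mult_ac)

lemma csubspaceD:
  assumes "csubspace W"
  shows "zvec \<in> W" "u \<in> W \<Longrightarrow> v \<in> W \<Longrightarrow> (\<lambda>y. u y + v y) \<in> W" "u \<in> W \<Longrightarrow> (\<lambda>y. c * u y) \<in> W"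
  using assms by (auto simp: csubspace_def)

lemma mvec_hat: "mvec B (hat x) = (\<lambda>y. B y x)"
proof
  fix y
  have "mvec B (hat x) y = (\<Sum>z\<in>UNIV. if x = z then B y z else 0)"
    unfolding mvec_def by (rule sum.cong) (auto simp: hat_apply)
  then show "mvec B (hat x) y = B y x" by simp
qed

context pq_scheme
begin

section \<open>Module criteria and annihilators\<close>

definition proj :: "'x \<Rightarrow> nat \<Rightarrow> 'x cvec \<Rightarrow> 'x cvec" where
  "proj x a w = (\<lambda>y. if dst x y = a then w y else 0)"

lemma mvec_diag: "mvec (\<lambda>y z. if y = z then c y else 0) w = (\<lambda>y. c y * w y)"
proof
  fix y
  have "mvec (\<lambda>y z. if y = z then c y else 0) w y = (\<Sum>z\<in>UNIV. if y = z then c y * w z else 0)"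
    unfolding mvec_def by (rule sum.cong) auto
  then show "mvec (\<lambda>y z. if y = z then c y else 0) w y = c y * w y" by simp
qed

lemma mvec_estar: "k \<le> D \<Longrightarrow> mvec (estar R k x) w = proj x k w"
  unfolding estar_def mvec_diag by (auto simp: proj_def adj_eq)

lemma mvec_astar: "mvec (astar E j x) w = (\<lambda>y. of_nat (card (UNIV :: 'x set)) * E j x y * w y)"
  unfolding astar_def mvec_diag ..

lemma sum_proj: "(\<Sum>a\<le>D. proj x a w y) = w y"
  by (simp add: proj_def dst_le)

lemma cinner_proj_sum: "cinner u w = (\<Sum>a\<le>D. cinner u (proj x a w))"
  by (simp add: cinner_sum_right[symmetric] sum_proj)

lemma cinner_E_sum: "cinner u w = (\<Sum>j\<le>D. cinner u (mvec (E j) w))"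
proof -
  have "(\<Sum>j\<le>D. mvec (E j) w y) = w y" for y
  proof -
    have "(\<Sum>j\<le>D. mvec (E j) w y) = (\<Sum>z\<in>UNIV. \<Sum>j\<le>D. E j y z * w z)"
      unfolding mvec_def by (rule sum.swap)
    also have "\<dots> = (\<Sum>z\<in>UNIV. if y = z then w z else 0)"
      unfolding sum_distrib_right[symmetric] sum_E by (rule sum.cong) auto
    finally show ?thesis by simp
  qed
  then show ?thesis by (simp add: cinner_sum_right[symmetric])
qed

lemma adj_symmetric: "adj (R 1) x y = adj (R 1) y x" "cnj (adj (R 1) x y) = adj (R 1) x y"
  using M_sym[OF M_adj[OF D_pos]] by (auto simp: adj_def)

lemma cinner_adj: "cinner (mvec (adj (R 1)) u) v = cinner u (mvec (adj (R 1)) v)"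
  by (intro cinner_mvec adj_symmetric)

lemma cinner_E: "j \<le> D \<Longrightarrow> cinner (mvec (E j) u) v = cinner u (mvec (E j) v)"
  by (intro cinner_mvec E_sym E_real)

lemma cinner_dual: "cinner (\<lambda>y. E 1 x y * u y) v = cinner u (\<lambda>y. E 1 x y * v y)"
  using D_pos by (intro cinner_diag E_real)

text \<open>By metricity the adjacency matrix generates the Bose-Mesner algebra, and by the cometric
  property \<open>astar E 1 x\<close> generates the dual matrices, so invariance under these two
  suffices.\<close>

lemma tmoduleI:
  assumes S: "csubspace S"
    and A: "\<And>w. w \<in> S \<Longrightarrow> mvec (adj (R 1)) w \<in> S"
    and dual: "\<And>w. w \<in> S \<Longrightarrow> (\<lambda>y. E 1 x y * w y) \<in> S"
  shows "tmodule D R E x S"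
proof -
  have poly: "(\<lambda>y. poly p (E 1 x y) * w y) \<in> S" if "w \<in> S" for p w
    using that
  proof (induction p arbitrary: w)
    case 0
    then show ?case using csubspaceD(1)[OF S] by (simp add: zvec_def)
  next
    case (pCons a p)
    have "(\<lambda>y. a * w y + poly p (E 1 x y) * (E 1 x y * w y)) \<in> S"
      using pCons by (intro csubspaceD(2,3)[OF S] dual pCons.IH)
    then show ?case by (simp add: algebra_simps)
  qed
  \<comment> \<open>Induction on a bound for the distances carrying a nonzero coefficient.
    Multiplying the distance-\<open>i\<close> matrix by the adjacency matrix reaches distance
    \<open>i + 1\<close> with a nonzero coefficient and nothing beyond.\<close>
  have dst: "mvec (\<lambda>x y. c (dst x y)) w \<in> S" if w: "w \<in> S" and c: "\<And>k. i < k \<Longrightarrow> c k = 0" for i c w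
    using c
  proof (induction i arbitrary: c)
    case 0
    then have "c (dst x y) = (if x = y then c 0 else 0)" for x y
      using dst_eq_0[of x y] by auto
    then have "mvec (\<lambda>x y. c (dst x y)) w = mvec (\<lambda>x y. if x = y then c 0 else 0) w"
      by (simp only:)
    then show ?case unfolding mvec_diag using csubspaceD(3)[OF S w] by simp
  next
    case (Suc i)
    show ?case
    proof (cases "Suc i \<le> D")
      case False
      have "mvec (\<lambda>x y. c (dst x y)) w = mvec (\<lambda>x y. (if dst x y \<le> i then c (dst x y) else 0)) w"
        using False dst_le by (intro arg_cong2[where f = mvec] refl ext) (metis le_trans not_less_eq_eq)
      also have "\<dots> \<in> S" by (rule Suc.IH[of "\<lambda>k. if k \<le> i then c k else 0"]) simp
      finally show ?thesis .
    next
      case True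
      then have iD: "i \<le> D" by simp
      have "mmult (adj (R 1)) (adj (R i)) \<in> M" using D_pos iD by (intro M_mmult M_adj)
      then obtain q where q: "mmult (adj (R 1)) (adj (R i)) = (\<lambda>x y. q (dst x y))" by (auto simp: M_iff)
      have qc: "q (dst u v) = of_nat (card {z. dst u z = 1 \<and> dst z v = i})" for u v
      proof -
        have "q (dst u v) = mmult (adj (R 1)) (adj (R i)) u v" by (simp only: q)
        also have "\<dots> = (\<Sum>z\<in>UNIV. if z \<in> {z. dst u z = 1 \<and> dst z v = i} then 1 else 0)"
          unfolding mmult_def adj_eq[OF D_pos] adj_eq[OF iD] by (rule sum.cong) auto
        finally show ?thesis by (simp add: sum.If_cases)
      qed
      have q0: "q k = 0" if "k \<le> D" "Suc i < k" for k
      proof -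
        obtain v where v: "dst undefined v = k" using ex_dst[OF \<open>k \<le> D\<close>] by blast
        have "{z. dst undefined z = 1 \<and> dst z v = i} = {}"
        proof safe
          fix z assume "dst undefined z = 1" "i = dst z v"
          then show "z \<in> {}" using dst_triangle[of undefined v z] v that by linarith
        qed
        then show ?thesis using qc[of undefined v] v by simp
      qed
      obtain v where v: "dst undefined v = 1 + i" using ex_dst[of "1 + i"] True by auto
      then obtain z where "dst undefined z = 1" "dst z v = i" by (rule dst_intermediate)
      then have "card {z. dst undefined z = 1 \<and> dst z v = i} \<noteq> 0" by auto
      then have qn: "q (Suc i) \<noteq> 0" using qc[of undefined v] v by simp
      \<comment> \<open>\<open>b\<close> cancels the coefficient at \<open>Suc i\<close>. The cutoff
        in \<open>c'\<close> is there because \<open>q\<close> is arbitrary beyond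
        \<open>D\<close>.\<close>
      define b where "b = c (Suc i) / q (Suc i)"
      define c' where "c' k = (if k \<le> D then c k - b * q k else 0)" for k
      have "c' k = 0" if "i < k" for k
        using that Suc.prems[of k] q0[of k] qn by (cases "k = Suc i") (auto simp: c'_def b_def)
      then have 1: "mvec (\<lambda>x y. c' (dst x y)) w \<in> S" by (rule Suc.IH)
      have "mvec (\<lambda>x y. if dst x y = i then 1 else 0) w \<in> S"
        by (rule Suc.IH[of "\<lambda>k. if k = i then 1 else 0"]) simp
      then have "mvec (adj (R i)) w \<in> S" by (simp add: adj_eq iD)
      from A[OF this] have 2: "mvec (\<lambda>x y. q (dst x y)) w \<in> S" by (simp only: mvec_mmult[symmetric] q)
      have "mvec (\<lambda>x y. c (dst x y)) w
        = (\<lambda>y. mvec (\<lambda>x y. c' (dst x y)) w y + b * mvec (\<lambda>x y. q (dst x y)) w y)"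
        unfolding mvec_def sum_distrib_left sum.distrib[symmetric]
        by (intro ext sum.cong refl) (simp add: c'_def dst_le algebra_simps)
      then show ?thesis using csubspaceD(2)[OF S 1 csubspaceD(3)[OF S 2, of b]] by simp
    qed
  qed
  have "mvec B w \<in> S" if "B \<in> talg D R E x" "w \<in> S" for B w
    using that
  proof (induction B arbitrary: w)
    case (bm B)
    then obtain c where c: "B = (\<lambda>x y. c (dst x y))" by (auto simp: M_iff)
    then have "B = (\<lambda>x y. (\<lambda>k. if k \<le> D then c k else 0) (dst x y))" by (simp add: dst_le)
    then show ?case using dst[OF \<open>w \<in> S\<close>, of D "\<lambda>k. if k \<le> D then c k else 0"] by simp
  next
    case (dual i)
    obtain p where "\<And>x y. E i x y = poly p (E 1 x y)" using E_poly[OF dual(1)] by metis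
    then show ?case
      using csubspaceD(3)[OF S poly[OF dual(2), of p]] by (simp add: mvec_astar mult.assoc)
  next
    case (add B C)
    then show ?case using csubspaceD(2)[OF S add.IH(1)[OF add.prems] add.IH(2)[OF add.prems]]
      by (simp add: mvec_def algebra_simps sum.distrib)
  next
    case (smult B c)
    then show ?case using csubspaceD(3)[OF S] by (simp add: mvec_scale_mat)
  next
    case (mult B C)
    then show ?case by (simp add: mvec_mmult)
  qed
  with S show ?thesis by (simp add: tmodule_def)
qed

lemma tmodule_M: "tmodule D R E x W \<Longrightarrow> B \<in> M \<Longrightarrow> w \<in> W \<Longrightarrow> mvec B w \<in> W"
  unfolding tmodule_def by (blast intro: talg.bm)

text \<open>Row \<open>x\<close> of the expansion of a distance function in the \<open>E j\<close>
  writes the diagonal matrix through the \<open>astar E j x\<close>; in particular the projections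
  onto spheres preserve modules.\<close>

lemma tmodule_diag:
  assumes W: "tmodule D R E x W" and w: "w \<in> W"
  shows "(\<lambda>y. c (dst x y) * w y) \<in> W"
proof -
  let ?n = "of_nat (card (UNIV :: 'x set)) :: complex"
  have S: "csubspace W" using W by (simp add: tmodule_def)
  obtain \<beta> where \<beta>: "(\<lambda>x y. c (dst x y)) = (\<lambda>x y. \<Sum>j\<le>D. \<beta> j * E j x y)"
    using M_span[OF M_dst[of c]] by blast
  have "(\<lambda>y. \<Sum>j\<le>D. \<beta> j / ?n * mvec (astar E j x) w y) \<in> W"
    using W w by (intro csubspace_sum[OF S] csubspaceD(3)[OF S]) (auto simp: tmodule_def intro: talg.dual)
  moreover have "(\<Sum>j\<le>D. \<beta> j / ?n * mvec (astar E j x) w y) = c (dst x y) * w y" for y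
    using fun_cong[OF fun_cong[OF \<beta>], of x y] by (simp add: mvec_astar sum_distrib_right mult.assoc)
  ultimately show ?thesis by simp
qed

lemma tmodule_proj: "tmodule D R E x W \<Longrightarrow> w \<in> W \<Longrightarrow> proj x a w \<in> W"
  using tmodule_diag[of x W w "\<lambda>k. if k = a then 1 else 0"] by (simp add: proj_def if_distrib[of "\<lambda>c. c * _"] cong: if_cong)

lemma tmodule_perp:
  assumes A: "\<And>w. w \<in> P \<Longrightarrow> mvec (adj (R 1)) w \<in> P"
    and dual: "\<And>w. w \<in> P \<Longrightarrow> (\<lambda>y. E 1 x y * w y) \<in> P"
  shows "tmodule D R E x {v. \<forall>p\<in>P. cinner v p = 0}"
proof (rule tmoduleI)
  show "csubspace {v. \<forall>p\<in>P. cinner v p = 0}"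
    by (auto simp: csubspace_def cinner_add_left cinner_scale_left)
qed (use A dual in \<open>auto simp: cinner_adj[unfolded One_nat_def] cinner_dual[unfolded One_nat_def]\<close>)

text \<open>The raising and lowering argument for tridiagonal pairs, dualised: instead of intersecting
  partial sums of the eigenspaces, one works with their annihilators.\<close>

lemma irreducible_perp:
  assumes irr: "irreducible_tmodule D R E x W"
    and r: "\<And>a w. w \<in> W \<Longrightarrow> a < r \<Longrightarrow> proj x a w = zvec"
    and s: "s \<le> D" "w0 \<in> W" "mvec (E s) w0 \<noteq> zvec"
    and u_proj: "\<And>a w. w \<in> W \<Longrightarrow> r + i \<le> a \<Longrightarrow> cinner u (proj x a w) = 0"
    and u_E: "\<And>j w. w \<in> W \<Longrightarrow> j < s + i \<Longrightarrow> j \<le> D \<Longrightarrow> cinner u (mvec (E j) w) = 0"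
    and w: "w \<in> W"
  shows "cinner u w = 0"
proof -
  have W: "tmodule D R E x W" using irr by (simp add: irreducible_tmodule_def)
  then have sub: "csubspace W" by (simp add: tmodule_def)
  have AW: "mvec (adj (R 1)) w \<in> W" if "w \<in> W" for w
    using tmodule_M[OF W M_adj[OF D_pos] that] .
  have EW: "mvec (E j) w \<in> W" if "j \<le> D" "w \<in> W" for j w
    using tmodule_M[OF W E_M] that by blast
  obtain e where e: "E 1 = (\<lambda>x y. e (dst x y))" using E_M[OF D_pos] by (auto simp: M_iff)
  have dW: "(\<lambda>y. E 1 x y * w y) \<in> W" if "w \<in> W" for w
    unfolding e by (rule tmodule_diag[OF W that])
  \<comment> \<open>A ladder of annihilators: increasing \<open>i\<close> drops a sphere condition
    and adds an idempotent condition.\<close>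
  define K where "K i = {u. (\<forall>a. \<forall>w\<in>W. r + i \<le> a \<longrightarrow> cinner u (proj x a w) = 0) \<and>
    (\<forall>j\<le>D. \<forall>w\<in>W. j < s + i \<longrightarrow> cinner u (mvec (E j) w) = 0)}" for i
  have K0: "cinner u w = 0" if "u \<in> K 0" "w \<in> W" for u w
  proof -
    have "cinner u (proj x a w) = 0" for a
      using that r[OF that(2), of a] by (cases "a < r") (auto simp: K_def)
    then show ?thesis by (subst cinner_proj_sum[of _ _ x]) simp
  qed
  \<comment> \<open>The adjacency matrix changes distances by at most one, which costs one sphere
    index; subtracting the conjugate of its eigenvalue on \<open>E (s + i)\<close> gains that
    idempotent. If \<open>s + i\<close> exceeds \<open>D\<close>, any \<theta> will do.\<close>
  have raise: "\<exists>\<theta>. (\<lambda>y. mvec (adj (R 1)) u y - \<theta> * u y) \<in> K (Suc i)" if u: "u \<in> K i" for u i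
  proof -
    have "\<exists>\<theta>. s + i \<le> D \<longrightarrow> mmult (adj (R 1)) (E (s + i)) = (\<lambda>x y. \<theta> * E (s + i) x y)"
      using M_eigen[OF M_adj[OF D_pos]] by metis
    then obtain \<theta> where \<theta>: "s + i \<le> D \<Longrightarrow> mmult (adj (R 1)) (E (s + i)) = (\<lambda>x y. \<theta> * E (s + i) x y)"
      by blast
    let ?u = "\<lambda>y. mvec (adj (R 1)) u y - cnj \<theta> * u y"
    have "cinner ?u (proj x a w) = 0" if a: "r + Suc i \<le> a" and w: "w \<in> W" for a w
    proof -
      let ?v = "mvec (adj (R 1)) (proj x a w)"
      have "cinner u (proj x b ?v) = 0" for b
      proof (cases "r + i \<le> b")
        case True
        then show ?thesis using u AW tmodule_proj[OF W w] by (auto simp: K_def)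
      next
        case False
        have "proj x b ?v = zvec"
        proof
          fix y
          have "adj (R 1) y z * proj x a w z = 0" if "dst x y = b" for z
            using that False a dst_triangle[of x z y]
            by (auto simp: adj_eq[OF D_pos, unfolded One_nat_def] proj_def)
          then have "?v y = 0" if "dst x y = b"
            using that unfolding mvec_def by (intro sum.neutral) blast
          then show "proj x b ?v y = zvec y" by (simp add: proj_def zvec_def)
        qed
        then show ?thesis by simp
      qed
      then have "cinner u ?v = 0" by (subst cinner_proj_sum[of _ _ x]) simp
      moreover have "cinner u (proj x a w) = 0" using u a w by (auto simp: K_def)
      ultimately show ?thesis by (simp only: cinner_diff_scale_left cinner_adj) simp
    qed
    moreover have "cinner ?u (mvec (E j) w) = 0" if j: "j \<le> D" "j < s + Suc i" and w: "w \<in> W" for j w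
    proof -
      obtain \<eta> where \<eta>: "mmult (adj (R 1)) (E j) = (\<lambda>x y. \<eta> * E j x y)" "j = s + i \<Longrightarrow> \<eta> = \<theta>"
      proof (cases "j = s + i")
        case True
        then show ?thesis using that[of \<theta>] \<theta> j by blast
      next
        case False
        then show ?thesis using that M_eigen[OF M_adj[OF D_pos] j(1)] by metis
      qed
      have "cinner ?u (mvec (E j) w) = cinner u (mvec (mmult (adj (R 1)) (E j)) w) - cnj \<theta> * cinner u (mvec (E j) w)"
        by (simp only: cinner_diff_scale_left cinner_adj mvec_mmult)
      also have "\<dots> = (cnj \<eta> - cnj \<theta>) * cinner u (mvec (E j) w)"
        unfolding \<eta>(1) mvec_scale_mat cinner_scale_right by (simp add: algebra_simps)
      also have "\<dots> = 0" using \<eta>(2) u j w by (cases "j = s + i") (auto simp: K_def)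
      finally show ?thesis .
    qed
    ultimately show ?thesis unfolding K_def by blast
  qed
  \<comment> \<open>Dually, by \<open>E_dual_tridiagonal\<close>, multiplication by row
    \<open>x\<close> of \<open>E 1\<close> costs one idempotent index; subtracting the conjugate of
    its value at distance \<open>r + i\<close> regains that sphere.\<close>
  have lower: "\<exists>\<theta>. (\<lambda>y. E 1 x y * u y - \<theta> * u y) \<in> K i" if u: "u \<in> K (Suc i)" for u i
  proof -
    let ?\<theta> = "cnj (e (r + i))"
    let ?u = "\<lambda>y. E 1 x y * u y - ?\<theta> * u y"
    have "cinner ?u (proj x a w) = 0" if a: "r + i \<le> a" and w: "w \<in> W" for a w
    proof -
      have "(\<lambda>y. E 1 x y * proj x a w y) = (\<lambda>y. e a * proj x a w y)"
        unfolding e proj_def by auto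
      then have "cinner ?u (proj x a w) = (cnj (e a) - ?\<theta>) * cinner u (proj x a w)"
        by (simp only: cinner_diff_scale_left cinner_dual cinner_scale_right) (simp add: algebra_simps)
      also have "\<dots> = 0" using u a w by (cases "a = r + i") (auto simp: K_def)
      finally show ?thesis .
    qed
    moreover have "cinner ?u (mvec (E j) w) = 0" if j: "j \<le> D" "j < s + i" and w: "w \<in> W" for j w
    proof -
      let ?v = "\<lambda>y. E 1 x y * mvec (E j) w y"
      have v: "?v \<in> W" by (intro dW EW j w)
      have "cinner u (mvec (E k) ?v) = 0" if k: "k \<le> D" for k
      proof (cases "k < s + Suc i")
        case True
        then show ?thesis using u v k by (auto simp: K_def)
      next
        case False
        then show ?thesis using E_dual_tridiagonal[of k j x w] k j by simp
      qed
      then have "cinner u ?v = 0" by (subst cinner_E_sum) simp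
      moreover have "cinner u (mvec (E j) w) = 0" using u j w by (auto simp: K_def)
      ultimately show ?thesis by (simp only: cinner_diff_scale_left cinner_dual) simp
    qed
    ultimately show ?thesis unfolding K_def by blast
  qed
  \<comment> \<open>\<open>raise\<close> and \<open>lower\<close> make \<open>S\<close> a submodule;
    at the bottom of the ladder \<open>lower\<close> is replaced by \<open>K0\<close>.\<close>
  define S where "S = {w \<in> W. \<forall>i. \<forall>u\<in>K i. cinner u w = 0}"
  have S: "tmodule D R E x S"
  proof (rule tmoduleI)
    show "csubspace S"
      unfolding csubspace_def
      using csubspaceD[OF sub] by (auto simp: S_def cinner_add_right cinner_scale_right)
    fix w assume w: "w \<in> S"
    then have wW: "w \<in> W" by (simp add: S_def)
    have "cinner u (mvec (adj (R 1)) w) = 0" if u: "u \<in> K i" for u i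
    proof -
      obtain \<theta> where "(\<lambda>y. mvec (adj (R 1)) u y - \<theta> * u y) \<in> K (Suc i)" using raise[OF u] by blast
      then have "cinner (\<lambda>y. mvec (adj (R 1)) u y - \<theta> * u y) w = 0" "cinner u w = 0"
        using w u by (auto simp: S_def)
      then show ?thesis by (simp only: cinner_diff_scale_left cinner_adj) simp
    qed
    then show "mvec (adj (R 1)) w \<in> S" using AW[OF wW] by (simp add: S_def)
    have "cinner u (\<lambda>y. E 1 x y * w y) = 0" if u: "u \<in> K i" for u i
    proof (cases i)
      case 0
      then show ?thesis using K0 u dW[OF wW] by blast
    next
      case (Suc l)
      obtain \<theta> where "(\<lambda>y. E 1 x y * u y - \<theta> * u y) \<in> K l" using lower u Suc by blast
      then have "cinner (\<lambda>y. E 1 x y * u y - \<theta> * u y) w = 0" "cinner u w = 0"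
        using w u by (auto simp: S_def)
      then show ?thesis by (simp only: cinner_diff_scale_left cinner_dual) simp
    qed
    then show "(\<lambda>y. E 1 x y * w y) \<in> S" using dW[OF wW] by (simp add: S_def)
  qed
  \<comment> \<open>For positive \<open>i\<close> this is one of the conditions defining
    \<open>K i\<close>, as \<open>s < s + i\<close>; for \<open>i = 0\<close> it is
    \<open>K0\<close>. So \<open>S\<close> is nonzero and fills \<open>W\<close>.\<close>
  have "mvec (E s) w0 \<in> S"
  proof -
    have "cinner u (mvec (E s) w0) = 0" if u: "u \<in> K i" for u i
      using u s K0[of u "mvec (E s) w0"] EW[OF s(1,2)] by (cases i) (auto simp: K_def)
    then show ?thesis using EW s by (simp add: S_def)
  qed
  then have "S \<noteq> {zvec}" using s by blast
  moreover have "S \<subseteq> W" by (auto simp: S_def)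
  ultimately have "S = W" using irr S by (auto simp: irreducible_tmodule_def)
  moreover have "u \<in> K i" using u_proj u_E by (auto simp: K_def)
  ultimately show ?thesis using w by (auto simp: S_def)
qed

subsection \<open>Relative designs and antipodal fibres\<close>

lemma cinner_primary_perp:
  assumes "\<And>f. cinner w (\<lambda>y. f (dst x y)) = 0"
  shows "cinner (\<lambda>y. f (dst x y)) w = 0"
  using assms[of f] by (metis cinner_cnj complex_cnj_zero)

text \<open>Functions of the distance to \<open>x\<close> form the primary module: they are the
  columns at \<open>x\<close> of matrices in \<open>M\<close>, so the adjacency matrix preserves
  them.\<close>

lemma tmodule_primary_perp: "tmodule D R E x {v. \<forall>p\<in>range (\<lambda>f y. f (dst x y)). cinner v p = 0}"
proof (rule tmodule_perp)
  fix w :: "'x cvec" assume "w \<in> range (\<lambda>f y. f (dst x y))"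
  then obtain f where w: "w = (\<lambda>y. f (dst x y))" by blast
  obtain q where q: "mmult (adj (R 1)) (\<lambda>x y. f (dst x y)) = (\<lambda>x y. q (dst x y))"
    using M_mmult[OF M_adj[OF D_pos] M_dst[of f]] by (auto simp: M_iff)
  have "mvec (adj (R 1)) w y = q (dst x y)" for y
  proof -
    have "mvec (adj (R 1)) w y = mmult (adj (R 1)) (\<lambda>x y. f (dst x y)) y x"
      by (simp add: mvec_def mmult_def w dst_sym[of x])
    then show ?thesis by (simp only: q dst_sym[of x y])
  qed
  then show "mvec (adj (R 1)) w \<in> range (\<lambda>f y. f (dst x y))" by (intro range_eqI[of _ _ q]) auto
  obtain e where e: "E 1 = (\<lambda>x y. e (dst x y))" using E_M[OF D_pos] by (auto simp: M_iff)
  show "(\<lambda>y. E 1 x y * w y) \<in> range (\<lambda>f y. f (dst x y))"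
    unfolding e w by (rule range_eqI[of _ _ "\<lambda>k. e k * f k"]) simp
qed

text \<open>The design property puts the \<open>E j\<close> component of \<psi> into the primary
  module, and \<open>E j\<close> can be moved across the inner product.\<close>

lemma relative_design_perp:
  assumes des: "relative_design E t x \<psi>" and t: "t \<le> D" "j \<le> t"
    and w: "\<And>f. cinner w (\<lambda>y. f (dst x y)) = 0"
  shows "cinner \<psi> (mvec (E j) w) = 0"
proof -
  have j: "j \<le> D" using t by simp
  have "\<exists>c f. mvec (E j) \<psi> = (\<lambda>y. c * f (dst x y))"
  proof (cases "j = 0")
    \<comment> \<open>The design property is silent about \<open>j = 0\<close>, but
      \<open>E 0\<close> maps every vector to a constant one.\<close>
    case True
    let ?c = "\<Sum>z\<in>UNIV. 1 / of_nat (card (UNIV :: 'x set)) * \<psi> z"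
    have "mvec (E j) \<psi> = (\<lambda>y. ?c * (\<lambda>_. 1) (dst x y))"
      using True idem by (simp add: primitive_idempotents_def mvec_def)
    then show ?thesis by (intro exI)
  next
    case False
    then have "lin_dep2 (mvec (E j) \<psi>) (mvec (E j) (hat x))"
      using des t unfolding relative_design_def by simp
    then obtain a b where ab: "(a, b) \<noteq> (0, 0)" "\<And>y. a * mvec (E j) \<psi> y + b * E j y x = 0"
      unfolding lin_dep2_def mvec_hat zvec_def by metis
    have "a \<noteq> 0" using ab(1) ab(2)[of x] E_diag_nz[OF j, of x] by auto
    then have "mvec (E j) \<psi> = (\<lambda>y. - b / a * E j y x)"
      using ab(2) by (intro ext) (simp add: field_simps eq_neg_iff_add_eq_0)
    moreover obtain e where "E j = (\<lambda>x y. e (dst x y))" using E_M[OF j] by (auto simp: M_iff)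
    ultimately have "mvec (E j) \<psi> = (\<lambda>y. - b / a * e (dst x y))" by (simp add: dst_sym[of x])
    then show ?thesis by (intro exI)
  qed
  then obtain c f where "mvec (E j) \<psi> = (\<lambda>y. c * f (dst x y))" by blast
  then have "cinner \<psi> (mvec (E j) w) = c * cinner (\<lambda>y. f (dst x y)) w"
    by (simp add: cinner_E[OF j, symmetric] cinner_scale_left)
  then show ?thesis using cinner_primary_perp[OF w] by simp
qed

lemma sphere_subset_code:
  assumes t: "t \<le> D" "\<delta> \<le> t"
    and des: "relative_design E t x (proj x \<delta> (chi Y))"
    and modules: "\<And>W. irreducible_tmodule D R E x W \<Longrightarrow> 1 \<le> endpoint D R x W \<Longrightarrow>
      endpoint D R x W \<le> \<delta> \<Longrightarrow> dual_endpoint D E W \<le> endpoint D R x W"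
    and y: "y \<in> Y" "dst x y = \<delta>" and z: "dst x z = \<delta>"
  shows "z \<in> Y"
proof (rule ccontr)
  assume zY: "z \<notin> Y"
  let ?\<psi> = "proj x \<delta> (chi Y)"
  let ?P = "range (\<lambda>f y. f (dst x y)) :: 'x cvec set"
  let ?S = "{v. dst x v = \<delta>}"
  \<comment> \<open>Subtracting the mean over the sphere removes the primary component; a missing
    point \<open>z\<close> next to a present point \<open>y\<close> on the sphere leaves a nonzero
    remainder.\<close>
  define c where "c = (\<Sum>v\<in>?S. chi Y v) / of_nat (card ?S)"
  define \<psi>' where "\<psi>' v = (if dst x v = \<delta> then chi Y v - c else 0)" for v
  have "card ?S \<noteq> 0" using z by auto
  then have sum0: "(\<Sum>v\<in>?S. chi Y v - c) = 0"
    by (simp add: sum_subtractf c_def)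
  have perp: "cinner \<psi>' (\<lambda>v. f (dst x v)) = 0" for f
  proof -
    have "cinner \<psi>' (\<lambda>v. f (dst x v)) = (\<Sum>v\<in>UNIV. if v \<in> ?S then (chi Y v - c) * cnj (f \<delta>) else 0)"
      unfolding cinner_def by (rule sum.cong) (auto simp: \<psi>'_def)
    also have "\<dots> = (\<Sum>v\<in>?S. chi Y v - c) * cnj (f \<delta>)"
      by (simp add: sum.If_cases sum_distrib_right)
    finally show ?thesis using sum0 by simp
  qed
  have "\<psi>' y = 1 - c" "\<psi>' z = - c" using y z zY by (auto simp: \<psi>'_def chi_def)
  then have nz: "\<psi>' \<noteq> zvec" by (auto simp: zvec_def)
  \<comment> \<open>The cyclic module generated by the remainder; it stays orthogonal to the primary
    module.\<close>
  define U where "U = \<Inter>{S. tmodule D R E x S \<and> \<psi>' \<in> S}"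
  have U: "tmodule D R E x U" unfolding tmodule_def csubspace_def U_def
    by (auto simp: tmodule_def csubspace_def)
  have \<psi>U: "\<psi>' \<in> U" by (auto simp: U_def)
  have UP: "U \<subseteq> {v. \<forall>p\<in>?P. cinner v p = 0}"
    unfolding U_def using tmodule_primary_perp perp by (intro Inter_lower) auto
  obtain W where W: "W \<subseteq> U" "irreducible_tmodule D R E x W"
    using exists_irreducible_submodule[OF U] \<psi>U nz by auto
  have Wmod: "tmodule D R E x W" and Wnz: "W \<noteq> {zvec}" using W(2) by (auto simp: irreducible_tmodule_def)
  have WP: "cinner w (\<lambda>v. f (dst x v)) = 0" if "w \<in> W" for w f
    using that W(1) UP by blast
  \<comment> \<open>Otherwise the annihilator of \<open>W\<close> is a module containing the
    generator of \<open>U\<close>, hence containing \<open>W\<close>, which would be orthogonal to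
    itself.\<close>
  have "\<exists>w\<in>W. cinner \<psi>' w \<noteq> 0"
  proof (rule ccontr)
    assume "\<not> (\<exists>w\<in>W. cinner \<psi>' w \<noteq> 0)"
    then have "\<psi>' \<in> {v. \<forall>w\<in>W. cinner v w = 0}" by blast
    moreover obtain e where "E 1 = (\<lambda>x y. e (dst x y))" using E_M[OF D_pos] by (auto simp: M_iff)
    then have "tmodule D R E x {v. \<forall>w\<in>W. cinner v w = 0}"
      using tmodule_M[OF Wmod M_adj[OF D_pos]] tmodule_diag[OF Wmod] by (intro tmodule_perp) auto
    ultimately have "U \<subseteq> {v. \<forall>w\<in>W. cinner v w = 0}" by (auto simp: U_def)
    then have "\<forall>w\<in>W. w = zvec" using W(1) cinner_self_eq_0 by blast
    moreover have "zvec \<in> W" using Wmod by (simp add: tmodule_def csubspace_def)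
    ultimately show False using Wnz by blast
  qed
  then obtain w0 where w0: "w0 \<in> W" "cinner \<psi>' w0 \<noteq> 0" by blast
  have \<psi>_split: "cinner ?\<psi> w = cinner \<psi>' w" if "w \<in> W" for w
  proof -
    have "?\<psi> = (\<lambda>v. \<psi>' v + (\<lambda>k. if k = \<delta> then c else 0) (dst x v))"
      by (auto simp: proj_def \<psi>'_def fun_eq_iff)
    then have "cinner ?\<psi> w = cinner \<psi>' w + cinner (\<lambda>v. (\<lambda>k. if k = \<delta> then c else 0) (dst x v)) w"
      by (simp only: cinner_add_left)
    then show ?thesis using cinner_primary_perp[OF WP[OF that], of "\<lambda>k. if k = \<delta> then c else 0"] by simp
  qed
  have \<psi>_proj: "cinner ?\<psi> (proj x a w) = (if a = \<delta> then cinner ?\<psi> w else 0)" for a w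
    by (auto simp: cinner_def proj_def intro!: sum.cong sum.neutral)
  have "\<delta> \<le> D" using t by simp
  let ?r = "endpoint D R x W"
  let ?Pr = "\<lambda>i. i \<le> D \<and> (\<exists>w\<in>W. mvec (estar R i x) w \<noteq> zvec)"
  have r\<delta>: "?Pr \<delta>"
  proof -
    have "proj x \<delta> w0 \<noteq> zvec" using \<psi>_proj[of \<delta> w0] \<psi>_split[OF w0(1)] w0(2) by auto
    then show ?thesis using mvec_estar[OF \<open>\<delta> \<le> D\<close>] w0(1) \<open>\<delta> \<le> D\<close> by auto
  qed
  have r_le: "?r \<le> \<delta>" unfolding endpoint_def by (rule Least_le[of ?Pr, OF r\<delta>])
  have r_min: "proj x a w = zvec" if "w \<in> W" "a < ?r" for a w
  proof -
    have "\<not> ?Pr a" using that(2) unfolding endpoint_def by (rule not_less_Least)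
    moreover have "a \<le> D" using that r_le \<open>\<delta> \<le> D\<close> by simp
    ultimately show ?thesis using that(1) mvec_estar by auto
  qed
  \<comment> \<open>Endpoint 0 would need a vector of \<open>W\<close> that is nonzero at
    \<open>x\<close>, but \<open>hat x\<close> belongs to the primary module.\<close>
  have r_pos: "1 \<le> ?r"
  proof (rule ccontr)
    assume "\<not> 1 \<le> ?r"
    then have "?r = 0" by simp
    moreover have "?Pr ?r" unfolding endpoint_def by (rule LeastI[of ?Pr, OF r\<delta>])
    ultimately obtain w where w: "w \<in> W" "proj x 0 w \<noteq> zvec" using mvec_estar[of 0] by auto
    have "cinner w (\<lambda>v. (\<lambda>k. if k = 0 then 1 else 0) (dst x v)) = (\<Sum>v\<in>UNIV. if x = v then w v else 0)"
      unfolding cinner_def by (rule sum.cong) (auto simp: dst_eq_0)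
    then have "w x = 0" using WP[OF w(1), of "\<lambda>k. if k = 0 then 1 else 0"] by simp
    then have "proj x 0 w = zvec" by (auto simp: proj_def zvec_def dst_eq_0)
    with w show False by blast
  qed
  let ?s = "dual_endpoint D E W"
  let ?Ps = "\<lambda>j. j \<le> D \<and> (\<exists>w\<in>W. mvec (E j) w \<noteq> zvec)"
  have "\<exists>j. ?Ps j"
  proof (rule ccontr)
    assume "\<not> (\<exists>j. ?Ps j)"
    then have "cinner \<psi>' w0 = 0" using w0(1) by (subst cinner_E_sum) auto
    with w0 show False by blast
  qed
  then have "?Ps ?s" unfolding dual_endpoint_def by (rule LeastI_ex)
  then obtain w1 where s: "?s \<le> D" "w1 \<in> W" "mvec (E ?s) w1 \<noteq> zvec" by blast
  have sr: "?s \<le> ?r" using modules[OF W(2) r_pos r_le] .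
  \<comment> \<open>The ladder is used at level \<delta> - r + 1. The spheres from \<delta> + 1 on
    miss the support of \<psi>, and since s \<le> r the idempotent conditions concern only j \<le>
    \<delta> \<le> t, where the design property applies.\<close>
  have "cinner ?\<psi> w0 = 0"
  proof (rule irreducible_perp[OF W(2) r_min s])
    show "cinner ?\<psi> (proj x a w) = 0" if "?r + (\<delta> - ?r + 1) \<le> a" for a w
      using that r_le \<psi>_proj[of a w] by simp
    show "cinner ?\<psi> (mvec (E j) w) = 0" if "w \<in> W" "j < ?s + (\<delta> - ?r + 1)" for j w
      using that r_le sr t by (intro relative_design_perp[OF des t(1)] WP) auto
  qed (use w0 in auto)
  with \<psi>_split w0 show False by simp
qed

section \<open>Antipodal fibres have two vertices\<close>

lemma antipodal_degree_1:
  assumes D3: "3 \<le> D"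
    and anti: "\<And>u v w. dst u v = D \<Longrightarrow> dst v w = D \<Longrightarrow> u = w \<or> dst u w = D"
  shows "card {z. dst x z = D} = 1"
proof (rule ccontr)
  assume ne1: "card {z. dst x z = D} \<noteq> 1"
  define k where "k = card {z. dst x z = D}"
  obtain x' where x': "dst x x' = D" using ex_dst[of D x] by blast
  then have "k \<noteq> 0" by (auto simp: k_def)
  moreover have "k \<noteq> 1" unfolding k_def by (rule ne1)
  ultimately have k2: "2 \<le> k" by linarith
  define K where "K = (of_nat k :: complex)"
  have K: "K \<noteq> 0" "K \<noteq> 1" "K + 1 \<noteq> 0"
    using k2 of_nat_neq_0[of k, where 'a = complex] by (auto simp: K_def add.commute)
  have D1: "1 \<le> D" and D2: "2 \<le> D" using D3 by auto
  obtain y where y: "dst x y = 1" using ex_dst[OF D1] by blast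
  obtain w where w: "dst x w = 2" using ex_dst[OF D2] by blast
  then obtain m where m: "dst x m = 1" "dst m w = 1" using dst_intermediate[of x w 1 1] by auto
  have near: "dst z y = D - 1" if "dst x z = D" for z
  proof -
    have "dst z y \<noteq> D"
    proof
      assume "dst z y = D"
      then have "x = y \<or> dst x y = D" using anti[of x z y] that by blast
      then show False using y D3 by auto
    qed
    moreover have "D \<le> 1 + dst z y" using dst_triangle[of x z y] that y by (simp add: dst_sym[of z y])
    ultimately show ?thesis using dst_le[of z y] by linarith
  qed
  have y': "dst x' y = D - 1" using near x' by blast
  text \<open>Evaluating \<open>A\<^sub>D E\<^sub>j = \<lambda> E\<^sub>j\<close> on \<open>R\<^sub>0\<close> and \<open>R\<^sub>1\<close>; the fibres force \<open>\<lambda> \<in> {K, -1}\<close>.\<close>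
  have eig: "\<exists>l. (l = K \<or> l = - 1) \<and> K * E j x x' = l * E j x x \<and> K * E j x' y = l * E j x y"
    if j: "j \<le> D" for j
  proof -
    obtain l where l: "mmult (adj (R D)) (E j) = (\<lambda>x y. l * E j x y)" using M_eigen[OF M_adj j] by blast
    have ev: "mmult (adj (R D)) (E j) u v = (\<Sum>z | dst u z = D. E j z v)" for u v
    proof -
      have "mmult (adj (R D)) (E j) u v = (\<Sum>z\<in>UNIV. if z \<in> {z. dst u z = D} then E j z v else 0)"
        unfolding mmult_def by (rule sum.cong) (auto simp: adj_eq)
      then show ?thesis by (simp add: sum.If_cases)
    qed
    have "l * E j x x = (\<Sum>z | dst x z = D. E j z x)" using ev[of x x] by (simp add: l)
    also have "\<dots> = (\<Sum>z | dst x z = D. E j x x')"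
      using x' by (intro sum.cong refl M_cong[OF E_M[OF j]]) (simp add: dst_sym[of _ x])
    finally have 1: "K * E j x x' = l * E j x x" by (simp add: k_def K_def)
    have "l * E j x y = (\<Sum>z | dst x z = D. E j z y)" using ev[of x y] by (simp add: l)
    also have "\<dots> = (\<Sum>z | dst x z = D. E j x' y)"
      using y' near by (intro sum.cong refl M_cong[OF E_M[OF j]]) simp
    finally have 2: "K * E j x' y = l * E j x y" by (simp add: k_def K_def)
    have fibre: "{z. dst x' z = D} = insert x ({z. dst x z = D} - {x'})"
    proof (intro set_eqI iffI)
      fix z assume "z \<in> {z. dst x' z = D}"
      then have z: "dst x' z = D" by simp
      then have "z \<noteq> x'" using D3 by auto
      then show "z \<in> insert x ({z. dst x z = D} - {x'})" using anti[OF x' z] by auto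
    next
      fix z assume "z \<in> insert x ({z. dst x z = D} - {x'})"
      then show "z \<in> {z. dst x' z = D}" using x' anti[of x' x z] by (auto simp: dst_sym[of x' x])
    qed
    have "l * E j x' x = (\<Sum>z | dst x' z = D. E j z x)" using ev[of x' x] by (simp add: l)
    also have "\<dots> = E j x x + (\<Sum>z\<in>{z. dst x z = D} - {x'}. E j z x)"
      unfolding fibre using D3 by (subst sum.insert) auto
    also have "(\<Sum>z\<in>{z. dst x z = D} - {x'}. E j z x) = (\<Sum>z\<in>{z. dst x z = D} - {x'}. E j x x')"
      using x' by (intro sum.cong refl M_cong[OF E_M[OF j]]) (simp add: dst_sym[of _ x])
    also have "\<dots> = (K - 1) * E j x x'" using x' k2 by (simp add: k_def K_def of_nat_diff)
    finally have l': "l * E j x x' = E j x x + (K - 1) * E j x x'" using E_sym[OF j, of x' x] by simp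
    have "l * (K * E j x x') = K * (l * E j x x')" by simp
    also have "\<dots> = K * E j x x + (K - 1) * (K * E j x x')" unfolding l' by (simp add: algebra_simps)
    finally have "l * (l * E j x x) = K * E j x x + (K - 1) * (l * E j x x)" unfolding 1 .
    then have "(l - K) * (l + 1) * E j x x = 0" by (simp add: algebra_simps)
    then have "l = K \<or> l = - 1" using E_diag_nz[OF j, of x] by (auto simp: eq_neg_iff_add_eq_0)
    with 1 2 show ?thesis by blast
  qed
  define a where "a = E 1 x x"
  define b where "b = E 1 x y"
  have a0: "a \<noteq> 0" using E_diag_nz[OF D1] by (simp add: a_def)
  have ab: "a \<noteq> b" using E1_separates[of x x x y] y by (auto simp: a_def b_def)
  have aD: "E 1 x x' \<noteq> a" using E1_separates[of x x' x x] x' D3 by (auto simp: a_def)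
  obtain l1 where l1: "l1 = K \<or> l1 = - 1" "K * E 1 x x' = l1 * a" "K * E 1 x' y = l1 * b"
    using eig[OF D1] by (auto simp: a_def b_def)
  \<comment> \<open>The eigenvalue \<open>K\<close> would give \<open>E 1\<close> equal values at
    distances 0 and \<open>D\<close>, against \<open>E1_separates\<close>.\<close>
  have "l1 = - 1" using l1 aD K by auto
  then have vals: "E 1 x x' = - a / K" "E 1 x' y = - b / K" using l1 K by (auto simp: field_simps)
  have b0: "b \<noteq> 0"
  proof
    assume "b = 0"
    then have "E 1 x' y = E 1 x y" using vals by (simp add: b_def)
    then have "dst x' y = dst x y" by (rule E1_separates)
    then show False using y y' D3 by simp
  qed
  obtain p where p: "degree p = 2" "\<And>x y. E 2 x y = poly p (E 1 x y)" using E_poly[OF D2] by metis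
  obtain \<gamma> \<beta> \<alpha> where pp: "p = [:\<gamma>, \<beta>, \<alpha>:]" and \<alpha>: "\<alpha> \<noteq> 0"
  proof -
    have "p = [:coeff p 0, coeff p 1, coeff p 2:]"
      using p(1) by (intro poly_eqI) (auto simp: coeff_pCons coeff_eq_0 numeral_2_eq_2 split: nat.split)
    moreover have "coeff p 2 \<noteq> 0" using p(1) by (metis leading_coeff_0_iff degree_0 zero_neq_numeral)
    ultimately show ?thesis using that by blast
  qed
  have E2: "E 2 u v = \<gamma> + \<beta> * E 1 u v + \<alpha> * (E 1 u v)\<^sup>2" for u v
    by (simp add: p(2) pp algebra_simps power2_eq_square)
  obtain l2 where l2: "l2 = K \<or> l2 = - 1" "K * E 2 x x' = l2 * E 2 x x" "K * E 2 x' y = l2 * E 2 x y"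
    using eig[OF D2] by auto
  have b_eq: "b = - a"
    using l2(1)
  proof
    assume "l2 = K"
    then have eqs: "E 2 x x' = E 2 x x" "E 2 x' y = E 2 x y" using l2 K by auto
    \<comment> \<open>The quadratic takes equal values at \<open>c\<close> and
      \<open>- c / K\<close>; their difference has the factor \<open>c * (1 + 1 / K)\<close>.
      Comparing \<open>c = a\<close> with \<open>c = b\<close> would force a = b because
      \<open>K\<close> is not 1, so this case is contradictory.\<close>
    have *: "\<alpha> * c * (1 - 1 / K) + \<beta> = 0"
      if c: "\<gamma> + \<beta> * (- c / K) + \<alpha> * (- c / K)\<^sup>2 = \<gamma> + \<beta> * c + \<alpha> * c\<^sup>2" "c \<noteq> 0" for c
    proof -
      have "c * (1 + 1 / K) * (\<alpha> * c * (1 - 1 / K) + \<beta>)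
        = (\<gamma> + \<beta> * c + \<alpha> * c\<^sup>2) - (\<gamma> + \<beta> * (- c / K) + \<alpha> * (- c / K)\<^sup>2)"
        using K by (simp add: field_simps power2_eq_square)
      also have "\<dots> = 0" unfolding c(1) by simp
      finally have "c * (1 + 1 / K) * (\<alpha> * c * (1 - 1 / K) + \<beta>) = 0" .
      moreover have "1 + 1 / K \<noteq> 0" using K by (simp add: field_simps add_eq_0_iff)
      ultimately show ?thesis using c(2) by simp
    qed
    have "\<alpha> * a * (1 - 1 / K) + \<beta> = 0" "\<alpha> * b * (1 - 1 / K) + \<beta> = 0"
      using *[OF eqs(1)[unfolded E2 vals a_def[symmetric]] a0]
        *[OF eqs(2)[unfolded E2 vals b_def[symmetric]] b0] by auto
    moreover have "\<alpha> * (a - b) * (1 - 1 / K)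
        = (\<alpha> * a * (1 - 1 / K) + \<beta>) - (\<alpha> * b * (1 - 1 / K) + \<beta>)" by (simp add: algebra_simps)
    ultimately have "\<alpha> * (a - b) * (1 - 1 / K) = 0" by simp
    moreover have "1 - 1 / K \<noteq> 0" using K by simp
    ultimately show ?thesis using \<alpha> ab by simp
  next
    assume "l2 = - 1"
    then have eqs: "K * E 2 x x' + E 2 x x = 0" "K * E 2 x' y + E 2 x y = 0" using l2 by auto
    \<comment> \<open>In this combination of the values at \<open>c\<close> and
      \<open>- c / K\<close> the linear terms cancel, so a and b have equal squares.\<close>
    have *: "\<alpha> * c\<^sup>2 / K + \<gamma> = 0"
      if c: "K * (\<gamma> + \<beta> * (- c / K) + \<alpha> * (- c / K)\<^sup>2) + (\<gamma> + \<beta> * c + \<alpha> * c\<^sup>2) = 0" for c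
    proof -
      have "(K + 1) * (\<alpha> * c\<^sup>2 / K + \<gamma>)
        = K * (\<gamma> + \<beta> * (- c / K) + \<alpha> * (- c / K)\<^sup>2) + (\<gamma> + \<beta> * c + \<alpha> * c\<^sup>2)"
        using K by (simp add: field_simps power2_eq_square)
      then show ?thesis using c K by auto
    qed
    have "\<alpha> * a\<^sup>2 / K + \<gamma> = 0" "\<alpha> * b\<^sup>2 / K + \<gamma> = 0"
      using *[OF eqs(1)[unfolded E2 vals a_def[symmetric]]]
        *[OF eqs(2)[unfolded E2 vals b_def[symmetric]]] by auto
    then have "\<alpha> * a\<^sup>2 / K = \<alpha> * b\<^sup>2 / K" by (metis add_right_cancel)
    then have "b\<^sup>2 = a\<^sup>2" using \<alpha> K by simp
    then show ?thesis using ab by (auto simp: power2_eq_iff)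
  qed
  \<comment> \<open>The sum of the two rows has squared norm 2a + 2b, which is zero. Two such flips
    along \<open>x\<close>, \<open>m\<close>, \<open>w\<close> identify distances 0 and 2.\<close>
  have flip: "E 1 u z = - E 1 v z" if uv: "dst u v = 1" for u v z
  proof -
    have "(\<Sum>z\<in>UNIV. (E 1 u z + E 1 v z) * cnj (E 1 u z + E 1 v z))
      = (\<Sum>z\<in>UNIV. E 1 u z * E 1 z u + E 1 u z * E 1 z v + E 1 v z * E 1 z u + E 1 v z * E 1 z v)"
    proof (intro sum.cong refl)
      fix z
      show "(E 1 u z + E 1 v z) * cnj (E 1 u z + E 1 v z)
        = E 1 u z * E 1 z u + E 1 u z * E 1 z v + E 1 v z * E 1 z u + E 1 v z * E 1 z v"
        unfolding complex_cnj_add E_real[OF D1] E_sym[OF D1, of z u] E_sym[OF D1, of z v]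
        by (simp add: algebra_simps)
    qed
    also have "\<dots> = E 1 u u + E 1 u v + E 1 v u + E 1 v v"
      unfolding sum.distrib E_mult[OF D1 D1] by simp
    also have "E 1 u u = a" unfolding a_def by (rule M_cong[OF E_M[OF D1]]) simp
    also have "E 1 v v = a" unfolding a_def by (rule M_cong[OF E_M[OF D1]]) simp
    also have "E 1 u v = b" unfolding b_def by (rule M_cong[OF E_M[OF D1]]) (simp add: uv y)
    also have "E 1 v u = b" unfolding b_def by (rule M_cong[OF E_M[OF D1]]) (simp add: uv y dst_sym[of v u])
    finally have "(\<Sum>z\<in>UNIV. (E 1 u z + E 1 v z) * cnj (E 1 u z + E 1 v z)) = 0" by (simp add: b_eq)
    from sum_mult_cnj_eq_0[OF this, of z] show ?thesis by (simp add: eq_neg_iff_add_eq_0)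
  qed
  have "E 1 x x = E 1 w x" using flip[OF m(1), of x] flip[OF m(2), of x] by simp
  then have "dst x x = dst w x" by (rule E1_separates)
  then show False using w by (simp add: dst_sym[of w])
qed

end

section \<open>Combining the sphere argument with the classification of closed codes\<close>

theorem theorem6p8:
  fixes R :: "nat \<Rightarrow> ('x::finite \<times> 'x) set" and E :: "nat \<Rightarrow> 'x cmat"
    and D t :: nat and Y :: "'x set"
  assumes scheme: "assoc_scheme D R" and D3: "D \<ge> 3"
    and metric: "metric_scheme D R"
    and idem: "primitive_idempotents D R E"
    and comet: "cometric D E"
    and not_cycle: "\<not> is_cycle_graph (R 1)"
    and Y_size: "1 < card Y" "card Y < card (UNIV :: 'x set)"
    and t_le: "t \<le> D"
    and design: "\<forall>k\<le>D. \<forall>x\<in>Y. relative_design E t x (mvec (estar R k x) (chi Y))"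
    and modules: "\<forall>x\<in>Y. \<forall>W. irreducible_tmodule D R E x W \<and> 1 \<le> endpoint D R x W
                    \<and> endpoint D R x W \<le> min_dist D R Y
                    \<longrightarrow> dual_endpoint D E W \<le> endpoint D R x W"
  shows "bipartite_half (R 1) Y
         \<or> (antipodal_double_cover D R \<and> (\<exists>x y. Y = {x, y} \<and> (x, y) \<in> R D))
         \<or> min_dist D R Y \<ge> t + 1"
proof (cases "t + 1 \<le> min_dist D R Y")
  case False
  interpret pq_scheme D R E
    by unfold_locales (fact scheme metric idem comet)+
  define \<delta> where "\<delta> = min_dist D R Y"
  let ?Q = "\<lambda>i. i \<noteq> 0 \<and> i \<le> D \<and> cinner (chi Y) (mvec (adj (R i)) (chi Y)) \<noteq> 0"
  \<comment> \<open>The inner product counts the ordered pairs of codewords at distance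
    \<open>i\<close>.\<close>
  have Q_iff: "?Q i \<longleftrightarrow> i \<noteq> 0 \<and> i \<le> D \<and> (\<exists>u\<in>Y. \<exists>v\<in>Y. dst u v = i)" for i
  proof (cases "i \<le> D")
    case True
    let ?S = "{p. fst p \<in> Y \<and> snd p \<in> Y \<and> dst (fst p) (snd p) = i}"
    have "cinner (chi Y) (mvec (adj (R i)) (chi Y))
      = (\<Sum>u\<in>UNIV. \<Sum>v\<in>UNIV. if (u, v) \<in> ?S then 1 else 0)"
      unfolding cinner_def mvec_def cnj_sum sum_distrib_left
      by (intro sum.cong refl) (auto simp: chi_def adj_eq[OF True])
    also have "\<dots> = (\<Sum>p\<in>UNIV. if p \<in> ?S then 1 else 0)"
      unfolding sum.cartesian_product UNIV_Times_UNIV by (intro sum.cong) auto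
    also have "\<dots> = of_nat (card ?S)" by (simp add: sum.If_cases)
    finally have "cinner (chi Y) (mvec (adj (R i)) (chi Y)) \<noteq> 0 \<longleftrightarrow> ?S \<noteq> {}" by simp
    then show ?thesis by auto
  qed simp
  obtain u v where uv: "u \<in> Y" "v \<in> Y" "u \<noteq> v"
    using Y_size(1) by (metis card_le_Suc0_iff_eq finite One_nat_def not_less)
  have Q_dst: "?Q (dst u v)" if "u \<in> Y" "v \<in> Y" "u \<noteq> v" for u v
    unfolding Q_iff using that dst_le[of u v] dst_eq_0[of u v] by blast
  have "?Q \<delta>" unfolding \<delta>_def min_dist_def by (rule LeastI[of ?Q, OF Q_dst[OF uv]])
  then obtain x y where xy: "x \<in> Y" "y \<in> Y" "dst x y = \<delta>" and \<delta>: "\<delta> \<noteq> 0" "\<delta> \<le> D"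
    unfolding Q_iff by blast
  have min: "\<delta> \<le> dst u v" if "u \<in> Y" "v \<in> Y" "u \<noteq> v" for u v
    unfolding \<delta>_def min_dist_def by (rule Least_le[of ?Q, OF Q_dst[OF that]])
  \<comment> \<open>The sphere argument applies at every codeword \<open>u\<close> that has a
    codeword \<open>v\<close> at distance \<delta>, because \<delta> \<le> t in this case.\<close>
  have closed: "w \<in> Y" if "u \<in> Y" "v \<in> Y" "dst u v = \<delta>" "dst u w = \<delta>" for u v w
  proof (rule sphere_subset_code[OF t_le _ _ _ that(2-4)])
    show "\<delta> \<le> t" using False by (simp add: \<delta>_def)
    show "relative_design E t u (proj u \<delta> (chi Y))"
      using design that(1) \<delta>(2) mvec_estar[OF \<delta>(2)] by metis
    show "dual_endpoint D E W \<le> endpoint D R u W"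
      if "irreducible_tmodule D R E u W" "1 \<le> endpoint D R u W" "endpoint D R u W \<le> \<delta>" for W
      using modules that \<open>u \<in> Y\<close> unfolding \<delta>_def by blast
  qed
  have "Y \<noteq> UNIV" "1 \<le> \<delta>" using Y_size(2) \<delta>(1) by auto
  then have "bipartite_half (R 1) Y \<or> Y = {z. z = x \<or> dst x z = D} \<and>
    (\<forall>u v w. dst u v = D \<longrightarrow> dst v w = D \<longrightarrow> u = w \<or> dst u w = D)"
    by (rule closed_code_cases[OF D3 not_cycle _ _ \<delta>(2) xy min closed])
  then show ?thesis
  proof
    assume anti: "Y = {z. z = x \<or> dst x z = D} \<and>
      (\<forall>u v w. dst u v = D \<longrightarrow> dst v w = D \<longrightarrow> u = w \<or> dst u w = D)"
    then have kD: "card {z. dst w z = D} = 1" for w by (intro antipodal_degree_1[OF D3]) blast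
    have rel: "(u, v) \<in> Id \<union> R D \<longleftrightarrow> u = v \<or> dst u v = D" for u v by (simp add: R_iff)
    have "equiv UNIV (Id \<union> R D)"
    proof (rule equivI)
      show "refl (Id \<union> R D)" by (rule reflI) simp
      show "sym (Id \<union> R D)" by (rule symI, unfold rel) (metis dst_sym)
      show "trans (Id \<union> R D)" by (rule transI, unfold rel) (metis anti)
    qed simp
    moreover have "card {v. (u, v) \<in> Id \<union> R D} = 2" for u
    proof -
      have "{v. (u, v) \<in> Id \<union> R D} = insert u {v. dst u v = D}" unfolding rel by auto
      moreover have "u \<notin> {v. dst u v = D}" using D3 by auto
      ultimately show ?thesis using kD[of u] by simp
    qed
    ultimately have "antipodal_double_cover D R" unfolding antipodal_double_cover_def by blast
    moreover obtain z where z: "{z. dst x z = D} = {z}" using kD[of x] card_1_singletonE by blast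
    then have "Y = {x, z}" "(x, z) \<in> R D" using anti by (auto simp: R_iff)
    ultimately show ?thesis by blast
  qed blast
qed blast

end
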